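(* Let $d$ be a positive integer with $4 \mid d$, and let $n$ be a positive integer. There exists a $d$-regular vertex-transitive nut graph of order $n$ if and only if $2 \mid n$ and $n \ge d + 4$.
   Context: All graphs are simple and finite. The order of a graph is its number of vertices. A nut graph is a non-trivial simple graph (i.e. with at least two vertices) whose $(0,1)$-adjacency matrix has a one-dimensional null space (over $\mathbb{R}$) spanned by a full vector, i.e. a vector with no zero entries. A graph is vertex-transitive if its automorphism group acts transitively on its vertices. *)

theory Defs
  imports "Graph_Theory.Graph_Theory" "Jordan_Normal_Form.Matrix_Kernel"
begin

text \<open>
  Finite simple graphs are the symmetric, loop-free finite digraphs without parallel arcs of
  \<^locale>\<open>pair_graph\<close>: the edge \<open>{u, v}\<close> is the pair of arcs \<open>(u, v)\<close> and \<open>(v, u)\<close>, so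
  \<^const>\<open>out_degree\<close> counts neighbours.
\<close>

definition regular_graph :: "nat \<Rightarrow> 'a pair_pre_digraph \<Rightarrow> bool" where
  "regular_graph d G \<longleftrightarrow> pair_graph G \<and> (\<forall>v\<in>pverts G. out_degree (with_proj G) v = d)"

definition automorphism ::
    "'a pair_pre_digraph \<Rightarrow> ('a, 'a \<times> 'a, 'a, 'a \<times> 'a) digraph_isomorphism \<Rightarrow> bool" where
  "automorphism G h \<longleftrightarrow>
    pre_digraph.digraph_isomorphism (with_proj G) h \<and> app_iso h (with_proj G) = with_proj G"

definition vertex_transitive :: "'a pair_pre_digraph \<Rightarrow> bool" where
  "vertex_transitive G \<longleftrightarrow> pair_graph G \<and>
    (\<forall>u\<in>pverts G. \<forall>v\<in>pverts G. \<exists>h. automorphism G h \<and> iso_verts h u = v)"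

text \<open>Rows and columns are indexed by the vertices in increasing order.\<close>

definition adjacency_matrix :: "'a::linorder pair_pre_digraph \<Rightarrow> real mat" where
  "adjacency_matrix G = (let vs = sorted_list_of_set (pverts G) in
    mat (length vs) (length vs) (\<lambda>(i, j). if (vs ! i, vs ! j) \<in> parcs G then 1 else 0))"

definition full_vec :: "real vec \<Rightarrow> bool" where
  "full_vec x \<longleftrightarrow> (\<forall>i<dim_vec x. x $ i \<noteq> 0)"

definition nut_graph :: "'a::linorder pair_pre_digraph \<Rightarrow> bool" where
  "nut_graph G \<longleftrightarrow> pair_graph G \<and> card (pverts G) \<ge> 2 \<and>
    kernel_dim (adjacency_matrix G) = 1 \<and>
    (\<exists>x \<in> carrier_vec (card (pverts G)). full_vec x \<and>
      mat_kernel (adjacency_matrix G) = range (\<lambda>c. c \<cdot>\<^sub>v x))"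

lemma adjacency_matrix_carrier:
  "adjacency_matrix G \<in> carrier_mat (card (pverts G)) (card (pverts G))"
  by (simp add: adjacency_matrix_def Let_def)

text \<open>
  The arc map of an automorphism is determined by its vertex map, so automorphisms are the usual
  adjacency-preserving permutations of the vertex set.
\<close>

lemma automorphism_iff:
  assumes "pair_graph G"
  shows "(\<exists>h. automorphism G h \<and> (\<forall>v\<in>pverts G. iso_verts h v = f v)) \<longleftrightarrow>
    bij_betw f (pverts G) (pverts G) \<and>
    (\<forall>u\<in>pverts G. \<forall>v\<in>pverts G. (f u, f v) \<in> parcs G \<longleftrightarrow> (u, v) \<in> parcs G)"
    (is "?L \<longleftrightarrow> ?R")
proof -
  interpret pair_graph G by fact
  show ?thesis
  proof
    assume ?L
    then obtain h where iso: "pre_digraph.digraph_isomorphism (with_proj G) h"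
      and app: "app_iso h (with_proj G) = with_proj G"
      and f: "\<forall>v\<in>pverts G. iso_verts h v = f v"
      by (auto simp: automorphism_def)
    from app have V: "iso_verts h ` pverts G = pverts G" and A: "iso_arcs h ` parcs G = parcs G"
      and T: "iso_tail h = fst" and H: "iso_head h = snd"
      by (simp_all add: app_iso_def with_proj_def)
    have inj: "inj_on (iso_verts h) (pverts G)"
      using iso by (simp add: pre_digraph.digraph_isomorphism_def)
    have inj_f: "inj_on f (pverts G)" using inj f inj_on_cong[of "pverts G" "iso_verts h" f] by blast
    have img_f: "f ` pverts G = pverts G" using V f by (metis image_cong)
    have arc: "iso_arcs h (u, v) = (f u, f v)" if "(u, v) \<in> parcs G" for u v
      using iso that in_arcsD1[OF that] in_arcsD2[OF that] f
      by (fastforce simp: pre_digraph.digraph_isomorphism_def T H prod_eq_iff)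
    have "(u, v) \<in> parcs G" if uv: "u \<in> pverts G" "v \<in> pverts G" "(f u, f v) \<in> parcs G" for u v
    proof -
      obtain a b where ab: "(a, b) \<in> parcs G" "iso_arcs h (a, b) = (f u, f v)"
        using A uv(3) by (metis (no_types, lifting) imageE prod.exhaust)
      then have "f a = f u" "f b = f v" using arc by auto
      then have "a = u" "b = v"
        using inj_f uv ab in_arcsD1 in_arcsD2 by (meson inj_onD)+
      then show ?thesis using ab by simp
    qed
    moreover have "(f u, f v) \<in> parcs G" if "(u, v) \<in> parcs G" for u v
      using arc[OF that] A that by (metis imageI)
    ultimately show ?R using inj_f img_f by (auto simp: bij_betw_def)
  next
    assume R: ?R
    define h where "h = \<lparr>iso_verts = f, iso_arcs = (\<lambda>(u, v). (f u, f v)),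
      iso_head = (snd :: 'a \<times> 'a \<Rightarrow> 'a), iso_tail = (fst :: 'a \<times> 'a \<Rightarrow> 'a)\<rparr>"
    have inj: "inj_on f (pverts G)" and img: "f ` pverts G = pverts G"
      using R by (auto simp: bij_betw_def)
    have img': "(\<lambda>(u, v). (f u, f v)) ` parcs G = parcs G"
    proof
      show "(\<lambda>(u, v). (f u, f v)) ` parcs G \<subseteq> parcs G"
        using R in_arcsD1 in_arcsD2 by fastforce
      show "parcs G \<subseteq> (\<lambda>(u, v). (f u, f v)) ` parcs G"
      proof
        fix e assume e: "e \<in> parcs G"
        obtain a b where ab: "e = (a, b)" by (cases e)
        obtain u v where "u \<in> pverts G" "v \<in> pverts G" "a = f u" "b = f v"
          using e ab img in_arcsD1 in_arcsD2 by (metis imageE)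
        then show "e \<in> (\<lambda>(u, v). (f u, f v)) ` parcs G" using R e ab by force
      qed
    qed
    have inj': "inj_on (\<lambda>(u, v). (f u, f v)) (parcs G)"
    proof (rule inj_onI)
      fix e e' assume e: "e \<in> parcs G" "e' \<in> parcs G"
        and eq: "(\<lambda>(u, v). (f u, f v)) e = (\<lambda>(u, v). (f u, f v)) e'"
      have "fst e = fst e'" "snd e = snd e'"
        using eq inj_onD[OF inj] e arc_fst_in_verts arc_snd_in_verts
        by (simp_all add: case_prod_beta)
      then show "e = e'" by (rule prod_eqI)
    qed
    have "automorphism G h"
      unfolding automorphism_def pre_digraph.digraph_isomorphism_def
      using inj img inj' img' wf_digraph_axioms
      by (simp add: h_def app_iso_def with_proj_def case_prod_beta)
    then show ?L by (auto simp: h_def intro!: exI[of _ h])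
  qed
qed

end

theory Submission
  imports Defs "HOL-Analysis.Kronecker_Approximation_Theorem"
begin

text \<open>
  Necessity: a vertex-transitive nut graph has a kernel vector of constant modulus, and regularity
  forces its entries to sum to zero, so the order is even; order \<open>d + 2\<close> would mean a cocktail party
  graph, whose kernel is too large.

  Sufficiency: for \<open>n = 2 m\<close> take a Cayley graph of the dihedral group of order \<open>n\<close>, with adjacency
  matrix consisting of the blocks \<open>P, Q\<close> and \<open>Q\<^sup>T, P\<close>, where \<open>P\<close> and \<open>Q\<close> are \<open>m \<times> m\<close> circulants with
  \<open>d div 2\<close> ones per row and \<open>P\<close> is symmetric. The vector \<open>(1, -1)\<close> lies in the kernel. Index sets are
  chosen, by residue classes of \<open>m\<close> and \<open>d\<close>, such that the rest of the kernel is controlled either by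
  explicit factors \<open>S\<^sup>k - 1\<close> with \<open>S\<close> the cyclic shift and \<open>k\<close> prime to the period, or by an integer
  circulant whose integer kernel vectors are all even. By infinite descent the latter has no nonzero
  integer kernel vector, and by simultaneous Diophantine approximation no nonzero real one.
\<close>

section \<open>Periodic functions and circulant operators\<close>

definition periodic :: "int \<Rightarrow> (int \<Rightarrow> 'a) \<Rightarrow> bool" where
  "periodic m f \<longleftrightarrow> (\<forall>i. f (i + m) = f i)"

lemma iterate_shift:
  fixes f :: "int \<Rightarrow> real"
  assumes "\<And>i. f (i + k) = f i + c"
  shows "f (i + n * k) = f i + of_int n * c"
proof (induction n rule: int_induct[where k = 0])
  case base
  then show ?case by simp
next
  case (step1 n)
  have "f (i + (n + 1) * k) = f ((i + n * k) + k)" by (simp add: algebra_simps)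
  with step1 assms[of "i + n * k"] show ?case by (simp add: algebra_simps)
next
  case (step2 n)
  have "f (i + n * k) = f ((i + (n - 1) * k) + k)" by (simp add: algebra_simps)
  with step2 assms[of "i + (n - 1) * k"] show ?case by (simp add: algebra_simps)
qed

lemma periodic_mult:
  assumes "periodic m f"
  shows "f (i + n * m) = f i"
proof (induction n rule: int_induct[where k = 0])
  case base
  then show ?case by simp
next
  case (step1 n)
  have "f (i + (n + 1) * m) = f ((i + n * m) + m)" by (simp add: algebra_simps)
  with step1 assms show ?case by (simp add: periodic_def)
next
  case (step2 n)
  have "f (i + n * m) = f ((i + (n - 1) * m) + m)" by (simp add: algebra_simps)
  with step2 assms show ?case by (simp add: periodic_def)
qed

lemma periodic_mod:
  assumes "periodic m f"
  shows "f (i mod m) = f i"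
  using periodic_mult[OF assms, of "i mod m" "i div m"] by simp

text \<open>After \<open>m\<close> steps of length \<open>k\<close> the argument has moved by a
  multiple of the period, so the total increment \<open>m * c\<close> is zero. Bezout then writes
  the shift by 1 as a combination of \<open>k\<close> and \<open>m\<close>, both of which leave
  \<open>f\<close> unchanged.\<close>

lemma periodic_shift_const:
  fixes f :: "int \<Rightarrow> real"
  assumes per: "periodic m f" and m: "m > 0" and k: "coprime k m"
    and step: "\<And>i. f (i + k) = f i + c"
  shows "c = 0" and "f i = f j"
proof -
  have "f (0 + m * k) = f 0"
    using periodic_mult[OF per, of 0 k] by (simp add: mult.commute)
  with iterate_shift[of f k c 0 m] step m show c: "c = 0" by simp
  obtain x y where xy: "x * k + y * m = 1"
    using bezout_int[of k m] k by (auto simp: coprime_iff_gcd_eq_1)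
  have one: "f (i + 1) = f i + 0" for i
  proof -
    have "f (i + 1) = f ((i + x * k) + y * m)"
      using xy by (simp add: add.assoc)
    also have "\<dots> = f (i + x * k)" by (rule periodic_mult[OF per])
    also have "\<dots> = f i" using iterate_shift[of f k c i x] step c by simp
    finally show ?thesis by simp
  qed
  have "f i = f 0" for i
    using iterate_shift[of f 1 0 0 i] one by simp
  then show "f i = f j" by metis
qed

text \<open>The difference \<open>e\<close> of \<open>f\<close> along \<open>k\<close> is itself
  invariant under the shift by \<open>k\<close>, hence constant; so \<open>f\<close> has constant
  increments along \<open>k\<close>, and periodicity applies a second time.\<close>

lemma periodic_second_difference_const:
  fixes f :: "int \<Rightarrow> real"
  assumes per: "periodic m f" and m: "m > 0" and k: "coprime k m"
    and step: "\<And>i. f (i + 2 * k) + f i = 2 * f (i + k)"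
  shows "f i = f j"
proof -
  define e where "e i = f (i + k) - f i" for i
  have "periodic m e"
    using per unfolding e_def periodic_def by (metis add.commute add.left_commute)
  moreover have "e (i + k) = e i + 0" for i
    using step[of i] by (simp add: e_def algebra_simps)
  ultimately have e: "e i = e 0" for i
    using periodic_shift_const(2) m k by blast
  have "f (i + k) = f i + e 0" for i
    using e[of i] by (simp add: e_def)
  from periodic_shift_const(2)[OF per m k this] show ?thesis .
qed

section \<open>Sums over a period, and integer vectors in the kernel of a circulant\<close>

lemma sum_shift_period:
  fixes f :: "int \<Rightarrow> 'a::comm_monoid_add"
  assumes "periodic m f" and m: "m > 0"
  shows "(\<Sum>i\<in>{0..<m}. f (i + k)) = (\<Sum>i\<in>{0..<m}. f i)"
proof (rule sum.reindex_bij_witness[where i = "\<lambda>i. (i - k) mod m" and j = "\<lambda>i. (i + k) mod m"])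
  fix i assume "i \<in> {0..<m}"
  then show "((i + k) mod m - k) mod m = i" "((i - k) mod m + k) mod m = i"
    by (simp_all add: mod_diff_left_eq mod_add_left_eq)
  show "(i + k) mod m \<in> {0..<m}" "(i - k) mod m \<in> {0..<m}"
    using m by simp_all
  show "f ((i + k) mod m) = f (i + k)"
    by (rule periodic_mod[OF assms(1)])
qed

text \<open>Adding the equations over one period, every shift contributes the same total, so the row
  sum times that total is zero.\<close>

lemma circulant_sum_zero:
  fixes z :: "int \<Rightarrow> int"
  assumes "periodic m z" and "m > 0"
    and "\<And>i. (\<Sum>k\<in>K. a k * z (i + k)) = 0" and "(\<Sum>k\<in>K. a k) \<noteq> 0"
  shows "(\<Sum>i\<in>{0..<m}. z i) = 0"
proof -
  have "(\<Sum>k\<in>K. a k) * (\<Sum>i\<in>{0..<m}. z i) = (\<Sum>k\<in>K. a k * (\<Sum>i\<in>{0..<m}. z (i + k)))"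
    by (simp add: sum_shift_period[OF assms(1,2)] sum_distrib_right)
  also have "\<dots> = (\<Sum>i\<in>{0..<m}. \<Sum>k\<in>K. a k * z (i + k))"
    by (simp add: sum_distrib_left) (rule sum.swap)
  also have "\<dots> = 0" using assms(3) by simp
  finally show ?thesis using assms(4) by simp
qed

text \<open>Scale \<open>v\<close> so that its entry at \<open>i0\<close> is 1 and approximate one
  period simultaneously with common multiplier \<open>q\<close> and error below
  \<open>1 / N\<close>. As \<open>N\<close> exceeds the sum of the \<open>\<bar>a k\<bar>\<close>,
  each equation evaluated at the numerators \<open>z\<close> is an integer of absolute value below
  1, hence zero. At \<open>i0\<close> the approximated number is \<open>q\<close> itself, which is
  at least 1, so \<open>z i0\<close> cannot be 0.\<close>

lemma circulant_kernel_integer: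
  fixes v :: "int \<Rightarrow> real" and a :: "int \<Rightarrow> int"
  assumes per: "periodic m v" and m: "m > 0"
    and ker: "\<And>i. (\<Sum>k\<in>K. of_int (a k) * v (i + k)) = 0"
    and nz: "v i0 \<noteq> 0"
  obtains z :: "int \<Rightarrow> int"
  where "periodic m z" and "\<And>i. (\<Sum>k\<in>K. a k * z (i + k)) = 0" and "z i0 \<noteq> 0"
proof -
  define N :: nat where "N = nat (\<Sum>k\<in>K. \<bar>a k\<bar>) + 1"
  define \<theta> where "\<theta> j = v (int j) / v i0" for j
  have "(\<Sum>k\<in>K. \<bar>a k\<bar>) < int N"
    using sum_nonneg[of K "\<lambda>k. \<bar>a k\<bar>"] by (simp add: N_def)
  then have N: "real_of_int (\<Sum>k\<in>K. \<bar>a k\<bar>) < real N" by linarith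
  have "N > 0" by (simp add: N_def)
  then obtain q p where q: "0 < q"
    and p: "\<And>j. j < nat m \<Longrightarrow> \<bar>of_int q * \<theta> j - of_int (p j)\<bar> < 1 / N"
    using Dirichlet_approx_simult[of N "nat m" \<theta>] by metis
  define z where "z i = p (nat (i mod m))" for i
  have close: "\<bar>of_int q * (v i / v i0) - of_int (z i)\<bar> < 1 / N" for i
    using p[of "nat (i mod m)"] m by (simp add: \<theta>_def z_def periodic_mod[OF per] nat_less_iff)
  have "periodic m z" by (simp add: periodic_def z_def)
  moreover have "(\<Sum>k\<in>K. a k * z (i + k)) = 0" for i
  proof -
    have "(\<Sum>k\<in>K. of_int (a k) * (of_int q * (v (i + k) / v i0)))
        = of_int q / v i0 * (\<Sum>k\<in>K. of_int (a k) * v (i + k))"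
      by (simp add: sum_distrib_left mult_ac)
    then have "real_of_int (\<Sum>k\<in>K. a k * z (i + k))
        = - (\<Sum>k\<in>K. of_int (a k) * (of_int q * (v (i + k) / v i0) - of_int (z (i + k))))"
      using ker[of i] by (simp add: right_diff_distrib sum_subtractf)
    then have "\<bar>real_of_int (\<Sum>k\<in>K. a k * z (i + k))\<bar>
        \<le> (\<Sum>k\<in>K. \<bar>of_int (a k) * (of_int q * (v (i + k) / v i0) - of_int (z (i + k)))\<bar>)"
      by (simp only: abs_minus_cancel sum_abs)
    also have "\<dots> \<le> (\<Sum>k\<in>K. \<bar>of_int (a k)\<bar> * (1 / N))"
      unfolding abs_mult by (intro sum_mono mult_left_mono less_imp_le[OF close]) auto
    also have "\<dots> = of_int (\<Sum>k\<in>K. \<bar>a k\<bar>) / N"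
      by (simp add: sum_divide_distrib)
    also have "\<dots> < 1"
      using N \<open>N > 0\<close> by (simp only: divide_less_eq of_nat_0_less_iff) simp
    finally show ?thesis by linarith
  qed
  moreover have "z i0 \<noteq> 0"
  proof
    assume "z i0 = 0"
    then have "real_of_int q < 1 / N" using close[of i0] nz q by simp
    also have "\<dots> \<le> 1" using \<open>N > 0\<close> by simp
    finally show False using q by simp
  qed
  ultimately show thesis by (rule that)
qed

text \<open>Infinite descent: an integer kernel vector has only even entries, and its half is again
  a periodic kernel vector, with smaller absolute value at \<open>i\<close>.\<close>

lemma circulant_kernel_trivial:
  fixes v :: "int \<Rightarrow> real" and a :: "int \<Rightarrow> int"
  assumes per: "periodic m v" and m: "m > 0"
    and ker: "\<And>i. (\<Sum>k\<in>K. of_int (a k) * v (i + k)) = 0"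
    and even: "\<And>z i. periodic m z \<Longrightarrow> (\<And>i. (\<Sum>k\<in>K. a k * z (i + k)) = 0) \<Longrightarrow> even (z i)"
  shows "v i = 0"
proof (rule ccontr)
  assume "v i \<noteq> 0"
  then obtain z where z: "periodic m z" "\<And>j. (\<Sum>k\<in>K. a k * z (j + k)) = 0" "z i \<noteq> 0"
    by (metis circulant_kernel_integer[OF per m ker])
  then show False
  proof (induction "nat \<bar>z i\<bar>" arbitrary: z rule: less_induct)
    case less
    have ev: "even (z j)" for j using even less.prems(1,2) by blast
    define y where "y j = z j div 2" for j
    have zy: "z j = 2 * y j" for j using ev by (simp add: y_def)
    have "periodic m y" using less.prems(1) by (simp add: periodic_def y_def)
    moreover have "(\<Sum>k\<in>K. a k * y (j + k)) = 0" for j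
    proof -
      have "2 * (\<Sum>k\<in>K. a k * y (j + k)) = (\<Sum>k\<in>K. a k * z (j + k))"
        by (simp add: zy sum_distrib_left mult_ac)
      then show ?thesis using less.prems(2) by simp
    qed
    moreover have "y i \<noteq> 0" "nat \<bar>y i\<bar> < nat \<bar>z i\<bar>" using zy[of i] less.prems(3) by auto
    ultimately show False using less.hyps by blast
  qed
qed

section \<open>Nut graphs through functions on the vertices\<close>

text \<open>The kernel of the adjacency matrix in terms of functions on vertices, free of the vertex
  ordering that indexes the matrix.\<close>

definition null_fun :: "'a pair_pre_digraph \<Rightarrow> ('a \<Rightarrow> real) \<Rightarrow> bool" where
  "null_fun G f \<longleftrightarrow> (\<forall>u\<in>pverts G. (\<Sum>v | (u, v) \<in> parcs G. f v) = 0)"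

lemma out_degree_eq_card:
  "out_degree (with_proj G) u = card {v. (u, v) \<in> parcs G}"
proof -
  have "out_arcs (with_proj G) u = Pair u ` {v. (u, v) \<in> parcs G}"
    by (auto simp: out_arcs_def)
  then show ?thesis
    by (simp add: out_degree_def card_image inj_on_def)
qed

lemma mat_kernel_adjacency_iff:
  fixes G :: "'a::linorder pair_pre_digraph"
  assumes "pair_graph G"
  defines "vs \<equiv> sorted_list_of_set (pverts G)"
  defines "n \<equiv> card (pverts G)"
  shows "Matrix.vec n (\<lambda>i. f (vs ! i)) \<in> mat_kernel (adjacency_matrix G) \<longleftrightarrow> null_fun G f"
proof -
  interpret pair_graph G by fact
  have fin: "finite (pverts G)" by (rule pair_finite_verts)
  have set: "set vs = pverts G" and dist: "distinct vs" and len: "length vs = n"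
    using fin by (simp_all add: vs_def n_def)
  have nb: "{v. (u, v) \<in> parcs G} = {v \<in> pverts G. (u, v) \<in> parcs G}" for u
    using in_arcsD2 by auto
  have row: "scalar_prod (Matrix.row (adjacency_matrix G) i) (Matrix.vec n (\<lambda>i. f (vs ! i)))
      = (\<Sum>v | (vs ! i, v) \<in> parcs G. f v)" if i: "i < n" for i
  proof -
    have "scalar_prod (Matrix.row (adjacency_matrix G) i) (Matrix.vec n (\<lambda>i. f (vs ! i)))
        = (\<Sum>j = 0..<n. if (vs ! i, vs ! j) \<in> parcs G then f (vs ! j) else 0)"
      using i by (auto simp: scalar_prod_def adjacency_matrix_def Let_def vs_def[symmetric] len
          intro!: sum.cong)
    also have "\<dots> = (\<Sum>v\<in>pverts G. if (vs ! i, v) \<in> parcs G then f v else 0)"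
      using sum.reindex_bij_betw[OF bij_betw_nth[OF dist _ set[symmetric]], of "{0..<n}"
          "\<lambda>v. if (vs ! i, v) \<in> parcs G then f v else 0"] len
      by (simp add: atLeast0LessThan)
    also have "\<dots> = (\<Sum>v | (vs ! i, v) \<in> parcs G. f v)"
      using fin by (simp add: nb sum.inter_filter)
    finally show ?thesis .
  qed
  have "Matrix.vec n (\<lambda>i. f (vs ! i)) \<in> mat_kernel (adjacency_matrix G)
      \<longleftrightarrow> (\<forall>i<n. scalar_prod (Matrix.row (adjacency_matrix G) i) (Matrix.vec n (\<lambda>i. f (vs ! i))) = 0)"
    using adjacency_matrix_carrier[of G]
    by (auto simp: mat_kernel_def n_def[symmetric] Matrix.vec_eq_iff)
  also have "\<dots> \<longleftrightarrow> (\<forall>i<n. (\<Sum>v | (vs ! i, v) \<in> parcs G. f v) = 0)"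
    using row by simp
  also have "\<dots> \<longleftrightarrow> (\<forall>u\<in>pverts G. (\<Sum>v | (u, v) \<in> parcs G. f v) = 0)"
    unfolding set[symmetric] using len by (simp add: all_set_conv_all_nth)
  finally show ?thesis by (simp add: null_fun_def)
qed

text \<open>Vectors correspond to functions through the sorted vertex list, which turns the kernel
  into \<open>null_fun\<close> and scalar multiples into pointwise multiples. In the converse
  direction the kernel dimension is computed from a single nonzero spanning vector.\<close>

lemma nut_graph_iff:
  fixes G :: "'a::linorder pair_pre_digraph"
  assumes G: "pair_graph G"
  shows "nut_graph G \<longleftrightarrow> card (pverts G) \<ge> 2 \<and>
    (\<exists>f. null_fun G f \<and> (\<forall>v\<in>pverts G. f v \<noteq> 0) \<and>
      (\<forall>g. null_fun G g \<longrightarrow> (\<exists>c. \<forall>v\<in>pverts G. g v = c * f v)))"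
    (is "_ \<longleftrightarrow> ?n \<ge> 2 \<and> ?R")
proof -
  interpret pair_graph G by fact
  define vs where "vs = sorted_list_of_set (pverts G)"
  define n where "n = card (pverts G)"
  let ?A = "adjacency_matrix G"
  let ?x = "\<lambda>f :: 'a \<Rightarrow> real. Matrix.vec n (\<lambda>i. f (vs ! i))"
  have set: "set vs = pverts G" and dist: "distinct vs" and len: "length vs = n"
    using pair_finite_verts by (simp_all add: vs_def n_def)
  have ker: "?x f \<in> mat_kernel ?A \<longleftrightarrow> null_fun G f" for f
    unfolding vs_def n_def by (rule mat_kernel_adjacency_iff[OF G])
  have carrier: "?A \<in> carrier_mat n n"
    unfolding n_def by (rule adjacency_matrix_carrier)
  have ex: "\<exists>f. x = ?x f" if "x \<in> carrier_vec n" for x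
  proof
    show "x = ?x (\<lambda>v. vec_index x (inv_into {..<n} ((!) vs) v))"
      using that dist len
      by (intro eq_vecI) (auto simp: inv_into_f_f inj_on_def nth_eq_iff_index_eq)
  qed
  have all: "(\<forall>i<n. Q (vs ! i)) \<longleftrightarrow> (\<forall>v\<in>pverts G. Q v)" for Q
    unfolding set[symmetric] using len by (simp add: all_set_conv_all_nth)
  have full: "full_vec (?x f) \<longleftrightarrow> (\<forall>v\<in>pverts G. f v \<noteq> 0)" for f
    using all[of "\<lambda>v. f v \<noteq> 0"] by (auto simp: full_vec_def)
  have mult: "?x g = c \<cdot>\<^sub>v ?x f \<longleftrightarrow> (\<forall>v\<in>pverts G. g v = c * f v)" for f g c
    using all[of "\<lambda>v. g v = c * f v"] by (auto simp: Matrix.vec_eq_iff)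
  have range: "mat_kernel ?A = range (\<lambda>c. c \<cdot>\<^sub>v ?x f) \<longleftrightarrow>
      null_fun G f \<and> (\<forall>g. null_fun G g \<longrightarrow> (\<exists>c. \<forall>v\<in>pverts G. g v = c * f v))" for f
  proof
    assume eq: "mat_kernel ?A = range (\<lambda>c. c \<cdot>\<^sub>v ?x f)"
    have "1 \<cdot>\<^sub>v ?x f \<in> mat_kernel ?A" unfolding eq by blast
    then have "null_fun G f" using ker by simp
    moreover have "\<exists>c. \<forall>v\<in>pverts G. g v = c * f v" if "null_fun G g" for g
    proof -
      have "?x g \<in> range (\<lambda>c. c \<cdot>\<^sub>v ?x f)" using that ker eq by simp
      then obtain c where "?x g = c \<cdot>\<^sub>v ?x f" by blast
      then show ?thesis using mult by simp
    qed
    ultimately show "null_fun G f \<and> (\<forall>g. null_fun G g \<longrightarrow> (\<exists>c. \<forall>v\<in>pverts G. g v = c * f v))"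
      by blast
  next
    assume R: "null_fun G f \<and> (\<forall>g. null_fun G g \<longrightarrow> (\<exists>c. \<forall>v\<in>pverts G. g v = c * f v))"
    show "mat_kernel ?A = range (\<lambda>c. c \<cdot>\<^sub>v ?x f)"
    proof (intro equalityI subsetI)
      fix x assume x: "x \<in> mat_kernel ?A"
      then obtain g where g: "x = ?x g"
        using ex carrier by (auto simp: mat_kernel_def)
      then have "null_fun G g" using x ker by simp
      then obtain c where "\<forall>v\<in>pverts G. g v = c * f v" using R by blast
      then have "x = c \<cdot>\<^sub>v ?x f" using mult g by simp
      then show "x \<in> range (\<lambda>c. c \<cdot>\<^sub>v ?x f)" by blast
    next
      fix x assume "x \<in> range (\<lambda>c. c \<cdot>\<^sub>v ?x f)"
      then obtain c where "x = c \<cdot>\<^sub>v ?x f" by blast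
      then have x: "x = ?x (\<lambda>v. c * f v)" using mult[of "\<lambda>v. c * f v" c f] by simp
      have "null_fun G (\<lambda>v. c * f v)"
        using R by (simp add: null_fun_def sum_distrib_left[symmetric])
      then show "x \<in> mat_kernel ?A" using x ker[of "\<lambda>v. c * f v"] by simp
    qed
  qed
  have dim: "kernel_dim ?A = 1"
    if n: "n \<ge> 2" and f: "full_vec (?x f)" "mat_kernel ?A = range (\<lambda>c. c \<cdot>\<^sub>v ?x f)" for f
  proof -
    interpret K: kernel n n ?A by (rule kernel.intro) (rule carrier)
    have inK: "?x f \<in> mat_kernel ?A" using f(2) range[of f] ker[of f] by simp
    have "K.Ker.gen_set {?x f}"
    proof -
      have "mat_kernel ?A \<subseteq> K.Ker.span {?x f}"
      proof
        fix x assume "x \<in> mat_kernel ?A"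
        then obtain c where x: "x = c \<cdot>\<^sub>v ?x f" using f(2) by blast
        have "?x f \<in> K.NC.span {?x f}"
          using K.NC.in_own_span[of "{?x f}"] by simp
        then have "x \<in> K.NC.span {?x f}"
          unfolding x by (rule K.NC.smult_in_span[rotated]) simp
        then show "x \<in> K.Ker.span {?x f}"
          using K.span_same inK by simp
      qed
      moreover have "K.Ker.span {?x f} \<subseteq> mat_kernel ?A"
        using K.Ker.span_is_subset2[of "{?x f}"] inK by simp
      ultimately show ?thesis by simp
    qed
    moreover have "?x f \<noteq> 0\<^sub>v n"
      using f(1) n by (auto simp: full_vec_def Matrix.vec_eq_iff intro!: exI[of _ 0])
    ultimately have "K.dim = 1" using K.Ker.dim1I inK by simp
    then show ?thesis by simp
  qed
  show ?thesis
  proof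
    assume nut: "nut_graph G"
    then obtain x where x: "x \<in> carrier_vec n" "full_vec x" "mat_kernel ?A = range (\<lambda>c. c \<cdot>\<^sub>v x)"
      unfolding nut_graph_def n_def by blast
    obtain f where f: "x = ?x f" using ex x(1) by blast
    have ?R
      using x(2,3) unfolding f full range by blast
    with nut show "?n \<ge> 2 \<and> ?R" by (simp add: nut_graph_def)
  next
    assume R: "?n \<ge> 2 \<and> ?R"
    then obtain f where f: "full_vec (?x f)" "mat_kernel ?A = range (\<lambda>c. c \<cdot>\<^sub>v ?x f)"
      unfolding full range by blast
    have "kernel_dim ?A = 1" using dim f R n_def by blast
    moreover have "?x f \<in> carrier_vec n" by simp
    ultimately show "nut_graph G"
      using R G f unfolding nut_graph_def n_def by blast
  qed
qed

text \<open>Lets a graph be given by a relation on any finite set: an enumeration \<open>e\<close>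
  of \<open>X\<close> carries the relation, its automorphisms and its kernel over to a graph on
  natural numbers.\<close>

lemma nut_graph_realization:
  fixes E :: "'a \<Rightarrow> 'a \<Rightarrow> bool"
  assumes fin: "finite X" and two: "card X \<ge> 2"
    and sym: "\<And>x y. x \<in> X \<Longrightarrow> y \<in> X \<Longrightarrow> E x y \<Longrightarrow> E y x"
    and irrefl: "\<And>x. x \<in> X \<Longrightarrow> \<not> E x x"
    and deg: "\<And>x. x \<in> X \<Longrightarrow> card {y \<in> X. E x y} = d"
    and trans: "\<And>x y. x \<in> X \<Longrightarrow> y \<in> X \<Longrightarrow>
      \<exists>h. bij_betw h X X \<and> (\<forall>a\<in>X. \<forall>b\<in>X. E (h a) (h b) \<longleftrightarrow> E a b) \<and> h x = y"
    and null: "\<And>x. x \<in> X \<Longrightarrow> (\<Sum>y | y \<in> X \<and> E x y. f y) = (0::real)"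
    and full: "\<And>x. x \<in> X \<Longrightarrow> f x \<noteq> 0"
    and unique: "\<And>g. (\<And>x. x \<in> X \<Longrightarrow> (\<Sum>y | y \<in> X \<and> E x y. g y) = 0) \<Longrightarrow>
      \<exists>c. \<forall>x\<in>X. g x = c * f x"
  shows "\<exists>G :: nat pair_pre_digraph.
    regular_graph d G \<and> vertex_transitive G \<and> nut_graph G \<and> card (pverts G) = card X"
proof -
  obtain e where e: "bij_betw e X {0..<card X}"
    using ex_bij_betw_finite_nat[OF fin] by blast
  then have inj: "inj_on e X" and img: "e ` X = {0..<card X}" by (auto simp: bij_betw_def)
  define G where "G = \<lparr>pverts = {0..<card X},
    parcs = (\<lambda>(x, y). (e x, e y)) ` {(x, y). x \<in> X \<and> y \<in> X \<and> E x y}\<rparr>"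
  have V: "pverts G = e ` X" by (simp add: G_def img)
  have arc: "(e x, e y) \<in> parcs G \<longleftrightarrow> E x y" if "x \<in> X" "y \<in> X" for x y
  proof
    assume "(e x, e y) \<in> parcs G"
    then obtain x' y' where "x' \<in> X" "y' \<in> X" "E x' y'" "e x = e x'" "e y = e y'"
      by (auto simp: G_def)
    with that inj show "E x y" by (auto dest: inj_onD)
  qed (use that in \<open>auto simp: G_def\<close>)
  have arcs: "\<exists>x\<in>X. \<exists>y\<in>X. a = (e x, e y) \<and> E x y" if "a \<in> parcs G" for a
    using that by (auto simp: G_def)
  have nb: "{v. (e x, v) \<in> parcs G} = e ` {y \<in> X. E x y}" if "x \<in> X" for x
  proof
    show "e ` {y \<in> X. E x y} \<subseteq> {v. (e x, v) \<in> parcs G}" using arc that by auto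
    show "{v. (e x, v) \<in> parcs G} \<subseteq> e ` {y \<in> X. E x y}"
    proof
      fix v assume "v \<in> {v. (e x, v) \<in> parcs G}"
      then obtain x' y where xy: "x' \<in> X" "y \<in> X" "e x = e x'" "v = e y" "E x' y"
        using arcs[of "(e x, v)"] by auto
      with that inj have "x' = x" by (simp add: inj_on_eq_iff)
      with xy show "v \<in> e ` {y \<in> X. E x y}" by blast
    qed
  qed
  have G: "pair_graph G"
  proof
    show "finite (pverts G)" by (simp add: V fin)
    have "parcs G \<subseteq> pverts G \<times> pverts G" using arcs by (force simp: V)
    then show "finite (parcs G)" by (rule finite_subset) (simp add: V fin)
    show "symmetric G"
      unfolding symmetric_def
    proof (rule symI, simp)
      fix a b assume "(a, b) \<in> parcs G"
      from arcs[OF this] obtain x y where "x \<in> X" "y \<in> X" "a = e x" "b = e y" "E x y" by blast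
      with arc[of y x] sym[of x y] show "(b, a) \<in> parcs G" by simp
    qed
    show "fst a \<noteq> snd a" if "a \<in> parcs G" for a
    proof -
      from arcs[OF that] obtain x y where xy: "x \<in> X" "y \<in> X" "a = (e x, e y)" "E x y" by blast
      with irrefl[of x] have "x \<noteq> y" by blast
      with xy inj show ?thesis by (simp add: inj_on_eq_iff)
    qed
  qed (use arcs in \<open>force simp: V\<close>)+
  have null_iff: "null_fun G g \<longleftrightarrow> (\<forall>x\<in>X. (\<Sum>y | y \<in> X \<and> E x y. g (e y)) = 0)" for g
  proof -
    have "(\<Sum>v | (e x, v) \<in> parcs G. g v) = (\<Sum>y | y \<in> X \<and> E x y. g (e y))"
      if "x \<in> X" for x
      using inj unfolding nb[OF that] by (subst sum.reindex) (auto intro: inj_on_subset)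
    then show ?thesis by (simp add: null_fun_def V)
  qed
  define r where "r = inv_into X e"
  have r: "r (e x) = x" if "x \<in> X" for x
    unfolding r_def using inj that by (rule inv_into_f_f)
  have "regular_graph d G"
    using G deg inj
    by (auto simp: regular_graph_def out_degree_eq_card V nb card_image inj_on_subset)
  moreover have "vertex_transitive G"
    unfolding vertex_transitive_def
  proof (intro conjI ballI)
    fix u v assume "u \<in> pverts G" "v \<in> pverts G"
    then obtain x y where xy: "x \<in> X" "y \<in> X" "u = e x" "v = e y" by (auto simp: V)
    from trans[OF xy(1,2)] obtain h where h: "bij_betw h X X"
      "\<And>a b. a \<in> X \<Longrightarrow> b \<in> X \<Longrightarrow> E (h a) (h b) \<longleftrightarrow> E a b" "h x = y" by blast
    have hX: "h a \<in> X" if "a \<in> X" for a using h(1) that by (auto simp: bij_betw_def)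
    have "bij_betw r (e ` X) X"
      unfolding r_def using e V by (metis bij_betw_inv_into img)
    then have "bij_betw (e \<circ> (h \<circ> r)) (e ` X) (e ` X)"
      using bij_betw_trans h(1) e img by metis
    then have "bij_betw (e \<circ> (h \<circ> r)) (pverts G) (pverts G)" by (simp add: V)
    moreover have "((e \<circ> (h \<circ> r)) a, (e \<circ> (h \<circ> r)) b) \<in> parcs G \<longleftrightarrow> (a, b) \<in> parcs G"
      if "a \<in> pverts G" "b \<in> pverts G" for a b
      using that by (auto simp: V r arc hX h(2))
    ultimately obtain \<phi> where \<phi>: "automorphism G \<phi>"
      "\<forall>v\<in>pverts G. iso_verts \<phi> v = (e \<circ> (h \<circ> r)) v"
      using automorphism_iff[OF G, of "e \<circ> (h \<circ> r)"] by blast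
    have "iso_verts \<phi> u = v"
      using \<phi>(2) xy r h(3) by (simp add: V)
    with \<phi>(1) show "\<exists>h. automorphism G h \<and> iso_verts h u = v" by blast
  qed (rule G)
  moreover have "nut_graph G"
    unfolding nut_graph_iff[OF G]
  proof (intro conjI exI)
    show "card (pverts G) \<ge> 2" by (simp add: G_def two)
    show "null_fun G (f \<circ> r)" using null by (simp add: null_iff r)
    show "\<forall>v\<in>pverts G. (f \<circ> r) v \<noteq> 0" using full by (auto simp: V r)
    show "\<forall>g. null_fun G g \<longrightarrow> (\<exists>c. \<forall>v\<in>pverts G. g v = c * (f \<circ> r) v)"
    proof (intro allI impI)
      fix g assume "null_fun G g"
      then have "\<exists>c. \<forall>x\<in>X. g (e x) = c * f x"
        by (intro unique) (simp add: null_iff)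
      then show "\<exists>c. \<forall>v\<in>pverts G. g v = c * (f \<circ> r) v" by (auto simp: V r)
    qed
  qed
  moreover have "card (pverts G) = card X" by (simp add: G_def)
  ultimately show ?thesis by blast
qed

section \<open>Necessity\<close>

text \<open>Composing \<open>f\<close> with an automorphism \<open>h\<close> gives another kernel
  function, hence a multiple \<open>c * f\<close>. Since \<open>h\<close> permutes the vertices, the
  sum of squares is unchanged, which forces \<open>c\<close> to be 1 or -1 unless
  \<open>f u = 0\<close>.\<close>

lemma vertex_transitive_nut_graph_abs_const:
  fixes G :: "'a::linorder pair_pre_digraph"
  assumes trans: "vertex_transitive G" and null: "null_fun G f"
    and unique: "\<And>g. null_fun G g \<Longrightarrow> \<exists>c. \<forall>v\<in>pverts G. g v = c * f v"
    and u: "u \<in> pverts G" and v: "v \<in> pverts G"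
  shows "\<bar>f u\<bar> = \<bar>f v\<bar>"
proof -
  have G: "pair_graph G" using trans by (simp add: vertex_transitive_def)
  interpret pair_graph G by fact
  obtain \<phi> where "automorphism G \<phi>" "iso_verts \<phi> u = v"
    using trans u v by (auto simp: vertex_transitive_def)
  then obtain h where h: "h u = v" and bij: "bij_betw h (pverts G) (pverts G)"
    and arc: "\<And>a b. a \<in> pverts G \<Longrightarrow> b \<in> pverts G \<Longrightarrow> (h a, h b) \<in> parcs G \<longleftrightarrow> (a, b) \<in> parcs G"
    using automorphism_iff[OF G, of "iso_verts \<phi>"] by blast
  have inj: "inj_on h (pverts G)" and img: "h ` pverts G = pverts G"
    using bij by (auto simp: bij_betw_def)
  have "null_fun G (f \<circ> h)"
    unfolding null_fun_def
  proof
    fix a assume a: "a \<in> pverts G"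
    have sub: "{b. (a, b) \<in> parcs G} \<subseteq> pverts G" using in_arcsD2 by auto
    have "{b. (h a, b) \<in> parcs G} = h ` {b. (a, b) \<in> parcs G}"
    proof
      show "h ` {b. (a, b) \<in> parcs G} \<subseteq> {b. (h a, b) \<in> parcs G}"
        using arc a sub by auto
      show "{b. (h a, b) \<in> parcs G} \<subseteq> h ` {b. (a, b) \<in> parcs G}"
      proof
        fix b assume b: "b \<in> {b. (h a, b) \<in> parcs G}"
        then have "b \<in> pverts G" using in_arcsD2 by auto
        then obtain b' where "b' \<in> pverts G" "b = h b'" using img by auto
        with arc[OF a] b show "b \<in> h ` {b. (a, b) \<in> parcs G}" by auto
      qed
    qed
    then have "(\<Sum>b | (a, b) \<in> parcs G. (f \<circ> h) b) = (\<Sum>b | (h a, b) \<in> parcs G. f b)"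
      using inj_on_subset[OF inj sub] by (simp add: sum.reindex)
    also have "\<dots> = 0" using null a img by (auto simp: null_fun_def)
    finally show "(\<Sum>b | (a, b) \<in> parcs G. (f \<circ> h) b) = 0" .
  qed
  then obtain c where c: "\<And>a. a \<in> pverts G \<Longrightarrow> f (h a) = c * f a"
    using unique by force
  have S: "(\<Sum>a\<in>pverts G. (f a)\<^sup>2) = c\<^sup>2 * (\<Sum>a\<in>pverts G. (f a)\<^sup>2)"
  proof -
    have "(\<Sum>a\<in>pverts G. (f a)\<^sup>2) = (\<Sum>a\<in>pverts G. (f (h a))\<^sup>2)"
      using sum.reindex_bij_betw[OF bij, of "\<lambda>a. (f a)\<^sup>2"] by simp
    also have "\<dots> = (\<Sum>a\<in>pverts G. c\<^sup>2 * (f a)\<^sup>2)"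
      by (intro sum.cong) (simp_all add: c power_mult_distrib)
    finally show ?thesis by (subst sum_distrib_left)
  qed
  show ?thesis
  proof (cases "f u = 0")
    case True
    then show ?thesis using c[OF u] h by simp
  next
    case False
    then have "(\<Sum>a\<in>pverts G. (f a)\<^sup>2) > 0"
      using u pair_finite_verts by (intro sum_pos2[of _ u]) auto
    with S have "c\<^sup>2 = 1" by simp
    then have "\<bar>c\<bar> = 1" by (auto simp: power2_eq_1_iff)
    then show ?thesis using c[OF u] h by (simp add: abs_mult)
  qed
qed

text \<open>Double counting: adding the equations of all vertices counts every value
  \<open>f v\<close> exactly \<open>d\<close> times.\<close>

lemma null_fun_sum_eq_0:
  assumes reg: "regular_graph d G" and d: "d > 0" and null: "null_fun G f"
  shows "(\<Sum>v\<in>pverts G. f v) = 0"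
proof -
  interpret pair_graph G using reg by (simp add: regular_graph_def)
  have deg: "card {u \<in> pverts G. (u, v) \<in> parcs G} = d" if "v \<in> pverts G" for v
  proof -
    have "{u \<in> pverts G. (u, v) \<in> parcs G} = {u. (v, u) \<in> parcs G}"
      using pair_sym_arcs in_arcsD1 by (auto simp: symmetric_def dest: symD)
    then show ?thesis using reg that by (simp add: regular_graph_def out_degree_eq_card)
  qed
  have "0 = (\<Sum>u\<in>pverts G. \<Sum>v | (u, v) \<in> parcs G. f v)"
    using null by (simp add: null_fun_def)
  also have "\<dots> = (\<Sum>u\<in>pverts G. \<Sum>v | v \<in> pverts G \<and> (u, v) \<in> parcs G. f v)"
    by (intro sum.cong refl) (auto dest: in_arcsD2)
  also have "\<dots> = (\<Sum>v\<in>pverts G. \<Sum>u | u \<in> pverts G \<and> (u, v) \<in> parcs G. f v)"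
    using pair_finite_verts by (intro sum.swap_restrict) auto
  also have "\<dots> = d * (\<Sum>v\<in>pverts G. f v)"
    by (simp add: deg sum_distrib_left)
  finally show ?thesis using d by simp
qed

text \<open>All values are \<open>a\<close> or \<open>- a\<close>, and a zero sum means that both
  signs occur equally often.\<close>

lemma even_card_of_abs_const:
  fixes f :: "'a \<Rightarrow> real"
  assumes "finite V" and a: "a > 0" and abs: "\<And>v. v \<in> V \<Longrightarrow> \<bar>f v\<bar> = a" and sum: "(\<Sum>v\<in>V. f v) = 0"
  shows "even (card V)"
proof -
  have "f v = (if f v > 0 then a else - a)" if "v \<in> V" for v
    using abs[OF that] a by (simp add: abs_if split: if_splits)
  then have "(\<Sum>v\<in>V. f v) = (\<Sum>v\<in>V. if f v > 0 then a else - a)"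
    by (intro sum.cong) auto
  also have "\<dots> = a * (real (card {v\<in>V. f v > 0}) - real (card {v\<in>V. \<not> f v > 0}))"
    using assms(1) by (simp add: sum.If_cases Int_def algebra_simps Collect_neg_eq[symmetric])
  finally have "card {v\<in>V. f v > 0} = card {v\<in>V. \<not> f v > 0}"
    using sum a by simp
  moreover have "card V = card {v\<in>V. f v > 0} + card {v\<in>V. \<not> f v > 0}"
    using assms(1) by (subst card_Un_disjoint[symmetric]) (auto intro: arg_cong[where f = card])
  ultimately show ?thesis by simp
qed

lemma regular_graph_order:
  assumes reg: "regular_graph d G" and "u \<in> pverts G"
  shows "card (pverts G) = d + 1 + card {v \<in> pverts G. v \<noteq> u \<and> (u, v) \<notin> parcs G}"
proof -
  interpret pair_graph G using reg by (simp add: regular_graph_def)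
  define N where "N = {v. (u, v) \<in> parcs G}"
  define M where "M = {v \<in> pverts G. v \<noteq> u \<and> (u, v) \<notin> parcs G}"
  have V: "pverts G = insert u (N \<union> M)"
    unfolding N_def M_def using assms(2) in_arcsD2 by auto
  have fin: "finite N" "finite M"
    using pair_finite_verts V by (metis finite_Un finite_insert)+
  have "u \<notin> N \<union> M" "N \<inter> M = {}"
    using pair_no_loops[of "(u, u)"] by (auto simp: N_def M_def)
  moreover have "card N = d"
    using reg assms(2) by (simp add: N_def regular_graph_def out_degree_eq_card)
  ultimately have "card (pverts G) = d + 1 + card M"
    using fin by (simp add: V card_Un_disjoint)
  then show ?thesis by (simp add: M_def)
qed

text \<open>The complement of such a graph would be a perfect matching, and a kernel vector restricted to
  one edge of that matching is again a kernel vector.\<close>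

lemma no_cocktail_party_nut_graph:
  fixes G :: "'a::linorder pair_pre_digraph"
  assumes reg: "regular_graph d G" and d: "d > 0" and nut: "nut_graph G"
  shows "card (pverts G) \<noteq> d + 2"
proof
  assume n: "card (pverts G) = d + 2"
  have G: "pair_graph G" using reg by (simp add: regular_graph_def)
  interpret pair_graph G by fact
  obtain f where null: "null_fun G f" and full: "\<And>v. v \<in> pverts G \<Longrightarrow> f v \<noteq> 0"
    and unique: "\<And>g. null_fun G g \<Longrightarrow> \<exists>c. \<forall>v\<in>pverts G. g v = c * f v"
    using nut nut_graph_iff[OF G] by blast
  \<comment> \<open>The partner of \<open>u\<close> in the complementary matching: order
    \<open>d + 2\<close> leaves each vertex exactly one other vertex that is not adjacent to
    it.\<close>
  define p where "p u = the_elem {v \<in> pverts G. v \<noteq> u \<and> (u, v) \<notin> parcs G}" for u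
  have p: "{v \<in> pverts G. v \<noteq> u \<and> (u, v) \<notin> parcs G} = {p u}" if "u \<in> pverts G" for u
  proof -
    have "card {v \<in> pverts G. v \<noteq> u \<and> (u, v) \<notin> parcs G} = 1"
      using regular_graph_order[OF reg that] n by simp
    then show ?thesis by (rule card_1_singletonE) (simp add: p_def)
  qed
  have pV: "p u \<in> pverts G" "p u \<noteq> u" if "u \<in> pverts G" for u
    using p[OF that] by blast+
  have pp: "p (p u) = u" if "u \<in> pverts G" for u
  proof -
    have "(p u, u) \<notin> parcs G"
      using p[OF that] pair_sym_arcs by (auto simp: symmetric_def dest: symD)
    then have "u \<in> {v \<in> pverts G. v \<noteq> p u \<and> (p u, v) \<notin> parcs G}" using that pV[OF that] by auto
    then show ?thesis using p[OF pV(1)[OF that]] by simp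
  qed
  have nbr: "(\<Sum>v | (u, v) \<in> parcs G. g v) = (\<Sum>v\<in>pverts G. g v) - g u - g (p u)"
    if "u \<in> pverts G" for u and g :: "'a \<Rightarrow> real"
  proof -
    have "{v. (u, v) \<in> parcs G} = pverts G - {u, p u}"
      using p[OF that] in_arcsD2 pair_no_loops by fastforce
    then show ?thesis
      using pair_finite_verts that pV[OF that] by (simp add: sum_diff)
  qed
  have fp: "f (p u) = - f u" if "u \<in> pverts G" for u
    using null nbr[OF that, of f] null_fun_sum_eq_0[OF reg d null] that by (simp add: null_fun_def)
  obtain u where u: "u \<in> pverts G" using n by fastforce
  define g where "g v = (if v = u \<or> v = p u then f v else 0)" for v
  have "(\<Sum>v\<in>pverts G. g v) = (\<Sum>v\<in>{u, p u}. f v)"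
    using pair_finite_verts u pV[OF u]
    by (intro sum.mono_neutral_cong_right) (auto simp: g_def)
  also have "\<dots> = 0" using pV[OF u] fp[OF u] by simp
  finally have sum: "(\<Sum>v\<in>pverts G. g v) = 0" .
  \<comment> \<open>With \<open>nbr\<close>, this cancellation on each matching edge together with
    the zero total of \<open>g\<close> makes every neighbour sum vanish.\<close>
  have gp: "g v + g (p v) = 0" if "v \<in> pverts G" for v
    using fp[OF that] pp[OF u] pp[OF that] by (auto simp: g_def)
  have "null_fun G g"
    unfolding null_fun_def
  proof
    fix v assume v: "v \<in> pverts G"
    show "(\<Sum>w | (v, w) \<in> parcs G. g w) = 0"
      using nbr[OF v, of g] gp[OF v] sum by linarith
  qed
  then obtain c where c: "\<And>v. v \<in> pverts G \<Longrightarrow> g v = c * f v" using unique by blast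
  \<comment> \<open>Since \<open>d > 0\<close> there is a vertex outside the chosen edge. There
    \<open>g\<close> is 0 and \<open>f\<close> is not, so the factor \<open>c\<close> is 0, although
    \<open>g\<close> is nonzero at \<open>u\<close>.\<close>
  have "card {u, p u} < card (pverts G)" using n d by (simp add: card_insert_if)
  then obtain w where "w \<in> pverts G" "w \<noteq> u" "w \<noteq> p u"
    using card_mono[of "{u, p u}" "pverts G"] by fastforce
  then have "c = 0" using c[of w] full by (simp add: g_def)
  then show False using c[OF u] full[OF u] by (simp add: g_def)
qed

text \<open>The order is even and at least \<open>d + 1\<close> with \<open>d\<close> even, so only
  \<open>d + 2\<close> has to be excluded to reach \<open>d + 4\<close>.\<close>

lemma nut_graph_order_necessary:
  fixes G :: "nat pair_pre_digraph"
  assumes d: "d > 0" "even d" and reg: "regular_graph d G" and trans: "vertex_transitive G"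
    and nut: "nut_graph G"
  shows "even (card (pverts G))" and "card (pverts G) \<ge> d + 4"
proof -
  have G: "pair_graph G" using reg by (simp add: regular_graph_def)
  interpret pair_graph G by fact
  obtain f where null: "null_fun G f" and full: "\<And>v. v \<in> pverts G \<Longrightarrow> f v \<noteq> 0"
    and unique: "\<And>g. null_fun G g \<Longrightarrow> \<exists>c. \<forall>v\<in>pverts G. g v = c * f v"
    using nut nut_graph_iff[OF G] by blast
  obtain u where u: "u \<in> pverts G" using nut by (fastforce simp: nut_graph_def)
  show even: "even (card (pverts G))"
  proof (rule even_card_of_abs_const)
    show "\<bar>f v\<bar> = \<bar>f u\<bar>" if "v \<in> pverts G" for v
      using vertex_transitive_nut_graph_abs_const[OF trans null unique that u] .
  qed (use pair_finite_verts full[OF u] null_fun_sum_eq_0[OF reg d(1) null] in auto)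
  have "card (pverts G) \<ge> d + 1"
    using regular_graph_order[OF reg u] by simp
  with even d(2) no_cocktail_party_nut_graph[OF reg d(1) nut] show "card (pverts G) \<ge> d + 4"
    by presburger
qed

section \<open>Bicirculant graphs\<close>

text \<open>The centred representatives of the residues modulo \<open>m\<close>. They allow index
  sets to be literally symmetric about 0 while distinct elements stay incongruent.\<close>

definition window :: "int \<Rightarrow> int set" where
  "window m = {k. - m < 2 * k \<and> 2 * k \<le> m}"

lemma inj_on_mod_window:
  fixes s :: int
  assumes "S \<subseteq> window m" and s: "s = 1 \<or> s = -1"
  shows "inj_on (\<lambda>k. (i + s * k) mod m) S"
proof (rule inj_onI)
  fix k l assume kl: "k \<in> S" "l \<in> S" and "(i + s * k) mod m = (i + s * l) mod m"
  then have "m dvd s * k - s * l" by (simp add: mod_eq_dvd_iff)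
  then have "m dvd s * (k - l)" by (simp add: right_diff_distrib)
  then have "m dvd s * (s * (k - l))" by (rule dvd_mult)
  then have "m dvd k - l" using s by auto
  moreover have "k \<in> window m" "l \<in> window m" using kl assms(1) by auto
  then have "\<bar>k - l\<bar> < m" by (auto simp: window_def)
  ultimately show "k = l" by (metis abs_if dvd_abs_iff eq_iff_diff_eq_0 zdvd_not_zless zero_less_abs_iff)
qed

lemma finite_window: "S \<subseteq> window m \<Longrightarrow> finite S"
  by (rule finite_subset[of _ "{-m..m}"]) (force simp: window_def)+

text \<open>Vertices are pairs of a residue modulo \<open>m\<close> and a side; the sign makes the arcs across the two
  sides symmetric, so that the graph is a Cayley graph of a dihedral group.\<close>

definition side_sign :: "bool \<Rightarrow> int" where
  "side_sign a = (if a then -1 else 1)"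

definition bicirculant_adj ::
    "int \<Rightarrow> int set \<Rightarrow> int set \<Rightarrow> int \<times> bool \<Rightarrow> int \<times> bool \<Rightarrow> bool" where
  "bicirculant_adj m P Q x y \<longleftrightarrow>
    (if snd x = snd y then (fst y - fst x) mod m \<in> (\<lambda>k. k mod m) ` P
     else (side_sign (snd x) * (fst y - fst x)) mod m \<in> (\<lambda>k. k mod m) ` Q)"

text \<open>Solving the adjacency condition for the neighbour, with \<open>side_sign\<close> being
  its own inverse, parametrises the neighbours by \<open>P\<close> and \<open>Q\<close>; the window
  condition prevents repetitions. This converts the kernel condition into circulant
  equations.\<close>

lemma sum_bicirculant_neighbours:
  fixes g :: "int \<times> bool \<Rightarrow> real"
  assumes m: "m > 0" and P: "P \<subseteq> window m" and Q: "Q \<subseteq> window m"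
  shows "(\<Sum>y | y \<in> {0..<m} \<times> UNIV \<and> bicirculant_adj m P Q (i, a) y. g y)
    = (\<Sum>k\<in>P. g ((i + k) mod m, a)) + (\<Sum>k\<in>Q. g ((i + side_sign a * k) mod m, \<not> a))"
proof -
  let ?p = "\<lambda>k. ((i + k) mod m, a)" and ?q = "\<lambda>k. ((i + side_sign a * k) mod m, \<not> a)"
  have sq: "side_sign b * (side_sign b * z) = z" for b z by (simp add: side_sign_def)
  have red: "(s * (x mod m - i)) mod m = (s * (x - i)) mod m" for s x
    by (metis mod_diff_left_eq mod_mult_right_eq)
  have "{y. y \<in> {0..<m} \<times> UNIV \<and> bicirculant_adj m P Q (i, a) y} = ?p ` P \<union> ?q ` Q" (is "?L = ?R")
  proof
    show "?R \<subseteq> ?L"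
      using m by (auto simp: bicirculant_adj_def red sq mod_diff_left_eq)
    show "?L \<subseteq> ?R"
    proof
      fix y assume y: "y \<in> ?L"
      obtain j b where jb: "y = (j, b)" by (cases y)
      with y have j: "j mod m = j" by simp
      show "y \<in> ?R"
      proof (cases "a = b")
        case True
        then obtain k where k: "k \<in> P" "(j - i) mod m = k mod m"
          using y jb by (auto simp: bicirculant_adj_def)
        from k(2) have "(i + k) mod m = (i + (j - i)) mod m" by (metis mod_add_right_eq)
        with j have "j = (i + k) mod m" by simp
        with k True jb show ?thesis by auto
      next
        case False
        then obtain k where k: "k \<in> Q" "(side_sign a * (j - i)) mod m = k mod m"
          using y jb by (auto simp: bicirculant_adj_def)
        have "(i + side_sign a * k) mod m = (i + side_sign a * (side_sign a * (j - i))) mod m"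
          using k(2) by (metis mod_add_right_eq mod_mult_right_eq)
        with j have "j = (i + side_sign a * k) mod m" by (simp add: sq)
        with k False jb show ?thesis by auto
      qed
    qed
  qed
  moreover have "sum g (?p ` P \<union> ?q ` Q) = sum g (?p ` P) + sum g (?q ` Q)"
    using finite_window[OF P] finite_window[OF Q] by (intro sum.union_disjoint) auto
  moreover have "inj_on (\<lambda>k. (i + 1 * k) mod m) P"
    by (rule inj_on_mod_window[OF P]) simp
  then have "inj_on ?p P" by (simp add: inj_on_def)
  then have "sum g (?p ` P) = (\<Sum>k\<in>P. g (?p k))" by (simp add: sum.reindex)
  moreover have "inj_on (\<lambda>k. (i + side_sign a * k) mod m) Q"
    by (rule inj_on_mod_window[OF Q]) (simp add: side_sign_def)
  then have "inj_on ?q Q" by (simp add: inj_on_def)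
  then have "sum g (?q ` Q) = (\<Sum>k\<in>Q. g (?q k))" by (simp add: sum.reindex)
  ultimately show ?thesis by simp
qed

lemma bicirculant_adj_mod:
  "bicirculant_adj m P Q (i mod m, a) (j mod m, b) \<longleftrightarrow> bicirculant_adj m P Q (i, a) (j, b)"
proof -
  have "(s * (j mod m - i mod m)) mod m = (s * (j - i)) mod m" for s
    by (metis mod_diff_eq mod_mult_right_eq)
  then show ?thesis by (simp add: bicirculant_adj_def mod_diff_eq)
qed

text \<open>Within a side, negating the difference is absorbed by the symmetry of \<open>P\<close>.
  Across the sides, the change of sign cancels against the change of
  \<open>side_sign\<close>.\<close>

lemma bicirculant_adj_swap:
  assumes "\<And>k. k \<in> P \<Longrightarrow> - k \<in> P"
  shows "bicirculant_adj m P Q (- i, \<not> a) (- j, \<not> b) \<longleftrightarrow> bicirculant_adj m P Q (i, a) (j, b)"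
    and "bicirculant_adj m P Q (j, b) (i, a) \<longleftrightarrow> bicirculant_adj m P Q (i, a) (j, b)"
proof -
  have "(- x) mod m \<in> (\<lambda>k. k mod m) ` P" if "x mod m \<in> (\<lambda>k. k mod m) ` P" for x
  proof -
    from that obtain k where "k \<in> P" "x mod m = k mod m" by blast
    then have "- k \<in> P" "(- x) mod m = (- k) mod m" using assms by (auto intro: mod_minus_cong)
    then show ?thesis by blast
  qed
  from this[of "i - j"] this[of "j - i"]
  have neg: "(i - j) mod m \<in> (\<lambda>k. k mod m) ` P \<longleftrightarrow> (j - i) mod m \<in> (\<lambda>k. k mod m) ` P"
    by auto
  show "bicirculant_adj m P Q (- i, \<not> a) (- j, \<not> b) \<longleftrightarrow> bicirculant_adj m P Q (i, a) (j, b)"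
    using neg by (auto simp: bicirculant_adj_def side_sign_def)
  show "bicirculant_adj m P Q (j, b) (i, a) \<longleftrightarrow> bicirculant_adj m P Q (i, a) (j, b)"
    using neg by (auto simp: bicirculant_adj_def side_sign_def)
qed

text \<open>The dihedral group acts: rotations move vertices within a side, reflections exchange the
  sides.\<close>

lemma bicirculant_transitive:
  assumes m: "m > 0" and sym: "\<And>k. k \<in> P \<Longrightarrow> - k \<in> P"
    and x: "x \<in> {0..<m} \<times> UNIV" and y: "y \<in> {0..<m} \<times> UNIV"
  shows "\<exists>h. bij_betw h ({0..<m} \<times> UNIV) ({0..<m} \<times> UNIV) \<and>
    (\<forall>v\<in>{0..<m} \<times> UNIV. \<forall>w\<in>{0..<m} \<times> UNIV.
      bicirculant_adj m P Q (h v) (h w) \<longleftrightarrow> bicirculant_adj m P Q v w) \<and> h x = y"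
proof -
  obtain i a j b where xy: "x = (i, a)" "y = (j, b)" by (cases x, cases y)
  have j: "j mod m = j" using y xy by simp
  show ?thesis
  proof (cases "a = b")
    case True
    let ?h = "\<lambda>c (k :: int, a :: bool). ((k + c) mod m, a)"
    have "bij_betw (?h (j - i)) ({0..<m} \<times> UNIV) ({0..<m} \<times> UNIV)"
      by (rule bij_betw_byWitness[where f' = "?h (i - j)"]) (use m in \<open>auto simp: mod_simps\<close>)
    moreover have "bicirculant_adj m P Q (?h c v) (?h c w) \<longleftrightarrow> bicirculant_adj m P Q v w" for c v w
      by (cases v; cases w) (simp add: bicirculant_adj_mod, simp add: bicirculant_adj_def)
    moreover have "?h (j - i) x = y" using xy True j by simp
    ultimately show ?thesis by blast
  next
    case False
    \<comment> \<open>A reflection, hence its own inverse; the offset \<open>i + j\<close> is what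
      sends \<open>i\<close> to \<open>j\<close>.\<close>
    let ?h = "\<lambda>(k :: int, a :: bool). ((- k + (i + j)) mod m, \<not> a)"
    have "bij_betw ?h ({0..<m} \<times> UNIV) ({0..<m} \<times> UNIV)"
      by (rule bij_betw_byWitness[where f' = ?h]) (use m in \<open>auto simp: mod_simps\<close>)
    moreover have "bicirculant_adj m P Q (?h v) (?h w) \<longleftrightarrow> bicirculant_adj m P Q v w" for v w
    proof (cases v; cases w)
      fix k c l d assume vw: "v = (k, c)" "w = (l, d)"
      have "bicirculant_adj m P Q (?h v) (?h w)
          \<longleftrightarrow> bicirculant_adj m P Q (- k, \<not> c) (- l, \<not> d)"
        unfolding vw by (simp add: bicirculant_adj_mod, simp add: bicirculant_adj_def)
      then show ?thesis using bicirculant_adj_swap(1)[OF sym] vw by simp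
    qed
    moreover have "?h x = y" using xy False j by simp
    ultimately show ?thesis by blast
  qed
qed

text \<open>Reduces each family to linear algebra with periodic functions: \<open>u\<close> and
  \<open>w\<close> are the restrictions of a kernel vector to the two sides. The vector that is 1 on
  one side and -1 on the other is in the kernel because \<open>P\<close> and \<open>Q\<close> have
  equal size.\<close>

lemma bicirculant_nut_graph:
  assumes m: "m > 0" and P: "P \<subseteq> window m" and Q: "Q \<subseteq> window m"
    and sym: "\<And>k. k \<in> P \<Longrightarrow> - k \<in> P" and zero: "0 \<notin> P" and card: "card P = d" "card Q = d"
    and kernel: "\<And>u w :: int \<Rightarrow> real. periodic m u \<Longrightarrow> periodic m w \<Longrightarrow>
      (\<And>i. (\<Sum>k\<in>P. u (i + k)) + (\<Sum>k\<in>Q. w (i + k)) = 0) \<Longrightarrow>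
      (\<And>i. (\<Sum>k\<in>P. w (i + k)) + (\<Sum>k\<in>Q. u (i - k)) = 0) \<Longrightarrow>
      \<exists>c. \<forall>i. u i = c \<and> w i = - c"
  shows "\<exists>G :: nat pair_pre_digraph. regular_graph (2 * d) G \<and> vertex_transitive G \<and>
    nut_graph G \<and> card (pverts G) = nat (2 * m)"
proof -
  let ?X = "{0..<m} \<times> (UNIV :: bool set)"
  let ?E = "bicirculant_adj m P Q"
  let ?f = "\<lambda>x. real_of_int (side_sign (snd x))"
  note nbr = sum_bicirculant_neighbours[OF m P Q]
  have cX: "card ?X = nat (2 * m)" using m by (simp add: card_cartesian_product)
  have "\<exists>G :: nat pair_pre_digraph. regular_graph (2 * d) G \<and> vertex_transitive G \<and>
    nut_graph G \<and> card (pverts G) = card ?X"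
  proof (rule nut_graph_realization[where f = ?f and E = ?E])
    show "finite ?X" by simp
    show "card ?X \<ge> 2" using m cX by simp
    show "?E y x" if "?E x y" for x y
      using that bicirculant_adj_swap(2)[OF sym] by (cases x; cases y) blast
    show "\<not> ?E x x" for x
    proof
      assume "?E x x"
      then obtain k where k: "k \<in> P" "0 mod m = k mod m" by (auto simp: bicirculant_adj_def)
      then have "m dvd k" by auto
      moreover have "\<bar>k\<bar> < m" using k(1) P m by (force simp: window_def)
      ultimately have "k = 0" by (metis abs_if dvd_abs_iff zdvd_not_zless zero_less_abs_iff)
      with k(1) zero show False by simp
    qed
    show "card {y \<in> ?X. ?E x y} = 2 * d" for x
    proof -
      obtain i a where x: "x = (i, a)" by (cases x)
      \<comment> \<open>The degree is the neighbour sum of the constant function 1.\<close>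
      have "real (card {y \<in> ?X. ?E x y}) = (\<Sum>y | y \<in> ?X \<and> ?E x y. 1)" by simp
      also have "\<dots> = real (2 * d)" unfolding x nbr[where g = "\<lambda>_. 1"] using card by simp
      finally show ?thesis by (simp only: of_nat_eq_iff)
    qed
    show "\<exists>h. bij_betw h ?X ?X \<and> (\<forall>v\<in>?X. \<forall>w\<in>?X. ?E (h v) (h w) \<longleftrightarrow> ?E v w) \<and> h x = y"
      if "x \<in> ?X" "y \<in> ?X" for x y
      using bicirculant_transitive[OF m sym that] .
    show "(\<Sum>y | y \<in> ?X \<and> ?E x y. ?f y) = 0" for x
    proof -
      obtain i a where x: "x = (i, a)" by (cases x)
      show ?thesis unfolding x nbr using card by (simp add: side_sign_def)
    qed
    show "?f x \<noteq> 0" for x by (simp add: side_sign_def)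
    fix g :: "int \<times> bool \<Rightarrow> real"
    assume g: "\<And>x. x \<in> ?X \<Longrightarrow> (\<Sum>y | y \<in> ?X \<and> ?E x y. g y) = 0"
    define u where "u i = g (i mod m, False)" for i
    define w where "w i = g (i mod m, True)" for i
    have "\<exists>c. \<forall>i. u i = c \<and> w i = - c"
    proof (rule kernel)
      show "periodic m u" "periodic m w" by (simp_all add: periodic_def u_def w_def)
      fix i
      have eq: "(\<Sum>k\<in>P. g ((i + k) mod m, a))
          + (\<Sum>k\<in>Q. g ((i + side_sign a * k) mod m, \<not> a)) = 0" for a
        using g[of "(i mod m, a)"] m unfolding nbr by (simp add: mod_simps)
      show "(\<Sum>k\<in>P. u (i + k)) + (\<Sum>k\<in>Q. w (i + k)) = 0"
        using eq[of False] by (simp add: u_def w_def side_sign_def)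
      show "(\<Sum>k\<in>P. w (i + k)) + (\<Sum>k\<in>Q. u (i - k)) = 0"
        using eq[of True] by (simp add: u_def w_def side_sign_def)
    qed
    then obtain c where c: "\<And>i. u i = c" "\<And>i. w i = - c" by blast
    have "g x = c * ?f x" if "x \<in> ?X" for x
    proof -
      obtain i a where x: "x = (i, a)" by (cases x)
      with that have "i mod m = i" by simp
      with c[of i] show ?thesis by (cases a) (simp_all add: x u_def w_def side_sign_def)
    qed
    then show "\<exists>c. \<forall>x\<in>?X. g x = c * ?f x" by blast
  qed
  then show ?thesis using cX by simp
qed

section \<open>Families of bicirculant nut graphs\<close>

lemma sum_uminus_symmetric:
  fixes S :: "int set"
  assumes "\<And>k. k \<in> S \<Longrightarrow> - k \<in> S"
  shows "(\<Sum>k\<in>S. g (- k)) = (\<Sum>k\<in>S. g k)"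
  by (rule sum.reindex_bij_witness[where i = uminus and j = uminus]) (use assms in auto)

definition annulus :: "int \<Rightarrow> int set" where
  "annulus s = {-s..-1} \<union> {1..s}"

text \<open>Modulo \<open>2 * h\<close> the two added intervals are the translate of
  \<open>annulus s\<close> by \<open>h\<close>: the negative half is moved by \<open>h\<close>, the
  positive half by \<open>- h\<close>, which keeps the set symmetric. On functions of period
  \<open>2 * h\<close> its circulant therefore factors as \<open>(1 + S^h) Y\<close>, with
  \<open>Y\<close> the circulant of \<open>annulus s\<close>.\<close>

definition core :: "int \<Rightarrow> int \<Rightarrow> int set" where
  "core s h = annulus s \<union> ({h-s..h-1} \<union> {1-h..s-h})"

lemma finite_annulus [simp]: "finite (annulus s)"
  by (simp add: annulus_def)

lemma finite_core [simp]: "finite (core s h)"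
  by (simp add: core_def)

lemma mem_annulus: "k \<in> annulus s \<longleftrightarrow> k \<noteq> 0 \<and> \<bar>k\<bar> \<le> s"
  by (auto simp: annulus_def)

lemma mem_core:
  "k \<in> core s h \<longleftrightarrow> k \<in> annulus s \<or> h - s \<le> k \<and> k < h \<or> h - s \<le> - k \<and> - k < h"
  by (auto simp: core_def)

lemma card_annulus: "s \<ge> 0 \<Longrightarrow> card (annulus s) = nat (2 * s)"
  unfolding annulus_def by (subst card_Un_disjoint) auto

lemma sum_core:
  fixes g :: "int \<Rightarrow> 'a::comm_monoid_add"
  assumes "s \<ge> 0" "2 * s < h"
  shows "(\<Sum>k\<in>core s h. g k)
    = (\<Sum>k\<in>annulus s. g k) + ((\<Sum>k\<in>{-s..-1}. g (k + h)) + (\<Sum>k\<in>{1..s}. g (k - h)))"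
proof -
  have "(\<Sum>k\<in>core s h. g k)
      = (\<Sum>k\<in>annulus s. g k) + (\<Sum>k\<in>{h-s..h-1} \<union> {1-h..s-h}. g k)"
    unfolding core_def using assms by (intro sum.union_disjoint) (auto simp: annulus_def)
  moreover have "(\<Sum>k\<in>{h-s..h-1} \<union> {1-h..s-h}. g k)
      = (\<Sum>k\<in>{h-s..h-1}. g k) + (\<Sum>k\<in>{1-h..s-h}. g k)"
    using assms by (intro sum.union_disjoint) auto
  moreover have "(\<Sum>k\<in>{h-s..h-1}. g k) = (\<Sum>k\<in>{-s..-1}. g (k + h))"
    by (rule sum.reindex_bij_witness[where i = "\<lambda>k. k + h" and j = "\<lambda>k. k - h"]) auto
  moreover have "(\<Sum>k\<in>{1-h..s-h}. g k) = (\<Sum>k\<in>{1..s}. g (k - h))"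
    by (rule sum.reindex_bij_witness[where i = "\<lambda>k. k - h" and j = "\<lambda>k. k + h"]) auto
  ultimately show ?thesis by simp
qed

lemma sum_annulus:
  fixes g :: "int \<Rightarrow> 'a::comm_monoid_add"
  shows "(\<Sum>k\<in>annulus s. g k) = (\<Sum>k\<in>{-s..-1}. g k) + (\<Sum>k\<in>{1..s}. g k)"
  unfolding annulus_def by (intro sum.union_disjoint) auto

lemma sum_core_periodic:
  fixes f :: "int \<Rightarrow> 'a::comm_monoid_add"
  assumes "s \<ge> 0" "2 * s < h" and per: "periodic (2 * h) f"
  shows "(\<Sum>k\<in>core s h. f (i + k)) = (\<Sum>k\<in>annulus s. f (i + k)) + (\<Sum>k\<in>annulus s. f (i + h + k))"
proof -
  have "f (i + (k - h)) = f (i + h + k)" for k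
    using periodic_mult[OF per, of "i + (k - h)" 1] by (simp add: algebra_simps)
  then have "(\<Sum>k\<in>{1..s}. f (i + (k - h))) = (\<Sum>k\<in>{1..s}. f (i + h + k))" by simp
  moreover have "(\<Sum>k\<in>{-s..-1}. f (i + (k + h))) = (\<Sum>k\<in>{-s..-1}. f (i + h + k))"
    by (simp add: algebra_simps)
  ultimately show ?thesis
    by (simp add: sum_core[OF assms(1,2)] sum_annulus[of "\<lambda>k. f (i + h + k)"])
qed

lemma card_core:
  assumes "s \<ge> 0" "2 * s < h"
  shows "card (core s h) = nat (4 * s)"
  using sum_core[OF assms, of "\<lambda>_. 1 :: nat"] assms card_annulus[of s] by simp

lemma annulus_uminus: "k \<in> annulus s \<Longrightarrow> - k \<in> annulus s"
  by (simp add: mem_annulus)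

lemma core_uminus: "k \<in> core s h \<Longrightarrow> - k \<in> core s h"
  using annulus_uminus by (fastforce simp: mem_core)

lemma core_subset_window: "s \<ge> 0 \<Longrightarrow> 2 * s < h \<Longrightarrow> core s h \<subseteq> window (2 * h)"
  by (auto simp: mem_core mem_annulus window_def)

lemma zero_not_in_core: "2 * s < h \<Longrightarrow> 0 \<notin> core s h"
  by (auto simp: mem_core mem_annulus)

text \<open>All entries share one parity, so their sum over a period has the parity of
  \<open>m * z 0\<close>; for odd \<open>m\<close> an even sum makes \<open>z 0\<close>
  even.\<close>

lemma even_of_consecutive_parity:
  fixes z :: "int \<Rightarrow> int"
  assumes "odd m" "m > 0" and step: "\<And>i. even (z i + z (i + 1))"
    and sum: "even (\<Sum>i\<in>{0..<m}. z i)"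
  shows "even (z i)"
proof -
  have "periodic 1 (\<lambda>i. even (z i))"
    unfolding periodic_def using step by (metis even_add)
  from periodic_mult[OF this, of 0] have par: "even (z i) \<longleftrightarrow> even (z 0)" for i
    by (metis add_0 mult.right_neutral)
  then have "even (\<Sum>i\<in>{0..<m}. z i - z 0)" by (intro dvd_sum) simp
  moreover have "(\<Sum>i\<in>{0..<m}. z i - z 0) = (\<Sum>i\<in>{0..<m}. z i) - m * z 0"
    using assms(2) by (simp add: sum_subtractf)
  ultimately have "even (z 0)" using sum assms(1) by simp
  then show ?thesis using par by simp
qed

text \<open>Writing \<open>S\<close> for the shift, the circulant of \<open>insert 0 P\<close> is \<open>1 + (1 + S\<^sup>h) Y\<close> with \<open>Y\<close> the
  circulant of \<open>B\<close>. An integer kernel vector \<open>z\<close> is then \<open>h\<close>-periodic, so \<open>z = - 2 Y z\<close> is even.\<close>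

lemma swap_nut_graph:
  assumes h: "h > 0" and P: "P \<subseteq> window (2 * h)" and sym: "\<And>k. k \<in> P \<Longrightarrow> - k \<in> P"
    and zero: "0 \<notin> P" and one: "1 \<in> P" and card: "card P = d"
    and B: "\<And>(f :: int \<Rightarrow> int) i. periodic (2 * h) f \<Longrightarrow>
      (\<Sum>k\<in>P. f (i + k)) = (\<Sum>k\<in>B. f (i + k)) + (\<Sum>k\<in>B. f (i + h + k))"
  shows "\<exists>G :: nat pair_pre_digraph. regular_graph (2 * d) G \<and> vertex_transitive G \<and>
    nut_graph G \<and> card (pverts G) = nat (4 * h)"
proof -
  \<comment> \<open>Exchanging 1 for 0 makes the \<open>Q\<close>-sum differ from the
    \<open>P\<close>-sum by just two terms, so both kernel equations share the same left-hand side
    in \<open>f1\<close> and \<open>f2\<close>.\<close>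
  let ?Q = "insert 0 P - {1}"
  have fin: "finite P" by (rule finite_window[OF P])
  have d: "d > 0" using fin one card by (auto simp: card_gt_0_iff)
  have inj: "v i = 0" if per: "periodic (2 * h) v" and ker: "\<And>i. v i + (\<Sum>k\<in>P. v (i + k)) = 0"
    for v :: "int \<Rightarrow> real" and i
  proof (rule circulant_kernel_trivial[where m = "2 * h" and K = "insert 0 P" and a = "\<lambda>_. 1"])
    show "(\<Sum>k\<in>insert 0 P. of_int 1 * v (i + k)) = 0" for i
      using ker[of i] zero fin by simp
    fix z :: "int \<Rightarrow> int" and i
    assume z: "periodic (2 * h) z" and kz: "\<And>i. (\<Sum>k\<in>insert 0 P. 1 * z (i + k)) = 0"
    define y where "y i = (\<Sum>k\<in>B. z (i + k))" for i
    have zy: "z i + (y i + y (i + h)) = 0" for i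
      using kz[of i] zero fin B[OF z, of i] by (simp add: y_def)
    have "y (i + h + h) = y i" for i
    proof -
      have "z (i + h + h + k) = z (i + k)" for k
        using periodic_mult[OF z, of "i + k" 1] by (simp add: algebra_simps)
      then show ?thesis by (simp add: y_def)
    qed
    \<comment> \<open>The sum \<open>y i + y (i + h)\<close> is unchanged by the shift by
      \<open>h\<close>, because \<open>y\<close> has period \<open>2 * h\<close>; hence so is
      \<open>z\<close>.\<close>
    then have zh: "z (i + h) = z i" for i
      using zy[of i] zy[of "i + h"] by simp
    have "y (i + h) = y i"
      unfolding y_def
    proof (rule sum.cong)
      fix k
      show "z (i + h + k) = z (i + k)" using zh[of "i + k"] by (simp add: algebra_simps)
    qed simp
    with zy[of i] have "z i = 2 * (- y i)" by simp
    then show "even (z i)" by simp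
  qed (use h per in auto)
  have "\<exists>G :: nat pair_pre_digraph. regular_graph (2 * d) G \<and> vertex_transitive G \<and>
    nut_graph G \<and> card (pverts G) = nat (2 * (2 * h))"
  proof (rule bicirculant_nut_graph[where P = P and Q = ?Q])
    show "2 * h > 0" using h by simp
    show "?Q \<subseteq> window (2 * h)" using P h by (auto simp: window_def)
    show "card ?Q = d" using fin one zero card by simp
    fix u w :: "int \<Rightarrow> real"
    assume per: "periodic (2 * h) u" "periodic (2 * h) w"
      and e1: "\<And>i. (\<Sum>k\<in>P. u (i + k)) + (\<Sum>k\<in>?Q. w (i + k)) = 0"
      and e2: "\<And>i. (\<Sum>k\<in>P. w (i + k)) + (\<Sum>k\<in>?Q. u (i - k)) = 0"
    have Q: "(\<Sum>k\<in>?Q. g k) = g 0 + (\<Sum>k\<in>P. g k) - g 1" for g :: "int \<Rightarrow> real"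
      using fin one zero by (simp add: sum_diff1)
    have f1: "(\<Sum>k\<in>P. u (i + k)) + (\<Sum>k\<in>P. w (i + k)) = w (i + 1) - w i" for i
      using e1[of i] by (simp add: Q)
    have f2: "(\<Sum>k\<in>P. u (i + k)) + (\<Sum>k\<in>P. w (i + k)) = u (i - 1) - u i" for i
      using e2[of i] sum_uminus_symmetric[OF sym, of "\<lambda>k. u (i + k)"] by (simp add: Q)
    \<comment> \<open>Equating the right-hand sides of \<open>f1\<close> and \<open>f2\<close> shows
      that \<open>u i + w (i + 1)\<close> does not depend on \<open>i\<close>.\<close>
    have "u (i + 1) + w (i + 1 + 1) = u i + w (i + 1) + 0" for i
      using f1[of "i + 1"] f2[of "i + 1"] by simp
    then have c: "u i + w (i + 1) = u 0 + w 1" for i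
      using iterate_shift[of "\<lambda>i. u i + w (i + 1)" 1 0 0 i] by simp
    define c where "c = u 0 + w 1"
    \<comment> \<open>By \<open>f1\<close> the circulant of \<open>insert 0 P\<close> maps
      \<open>u + w\<close> to the constant \<open>c\<close>. Its row sum is \<open>d + 1\<close>, so
      subtracting \<open>c / (d + 1)\<close> leaves a kernel vector.\<close>
    define q where "q i = u i + w i - c / (d + 1)" for i
    have "q i = 0" for i
    proof (rule inj)
      show "periodic (2 * h) q" using per by (simp add: periodic_def q_def)
      fix i
      have "(\<Sum>k\<in>P. q (i + k)) = w (i + 1) - w i - d * (c / (d + 1))"
        using f1[of i] card by (simp add: q_def sum.distrib sum_subtractf)
      also have "\<dots> = c - u i - w i - d * (c / (d + 1))"
        using c[of i] by (simp add: c_def)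
      also have "\<dots> = - q i"
        by (simp add: q_def field_simps)
      finally show "q i + (\<Sum>k\<in>P. q (i + k)) = 0" by simp
    qed
    then have uw: "u i + w i = c / (d + 1)" for i by (simp add: q_def)
    have step: "w (i + 1) = w i + (c - c / (d + 1))" for i
      using c[of i] uw[of i] by (simp add: c_def)
    have "c - c / (d + 1) = 0" and w: "w i = w 0" for i
      using periodic_shift_const[OF per(2) _ _ step] h by auto
    then have "c = 0" using d by (simp add: field_simps)
    then have "u i = - w 0 \<and> w i = - (- w 0)" for i using uw[of i] w[of i] by simp
    then show "\<exists>c. \<forall>i. u i = c \<and> w i = - c" by blast
  qed (use P sym zero card in auto)
  then show ?thesis by simp
qed

lemma nut_graph_order_4h_degree_8s:
  assumes s: "s \<ge> 1" "2 * s < h"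
  shows "\<exists>G :: nat pair_pre_digraph. regular_graph (nat (8 * s)) G \<and> vertex_transitive G \<and>
    nut_graph G \<and> card (pverts G) = nat (4 * h)"
proof -
  have "\<exists>G :: nat pair_pre_digraph. regular_graph (2 * nat (4 * s)) G \<and> vertex_transitive G \<and>
    nut_graph G \<and> card (pverts G) = nat (4 * h)"
    by (rule swap_nut_graph[where P = "core s h" and B = "annulus s"])
      (use s in \<open>auto simp: core_subset_window zero_not_in_core card_core
        sum_core_periodic mem_core mem_annulus\<close>)
  moreover have "2 * nat (4 * s) = nat (8 * s)" using s by simp
  ultimately show ?thesis by simp
qed

text \<open>Here the half period is \<open>2 * g\<close>, so \<open>- g\<close> is congruent to
  \<open>g + 2 * g\<close> modulo \<open>4 * g\<close>. The pair \<open>g\<close>,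
  \<open>- g\<close> thus consists of \<open>g\<close> and its translate by the half period, and
  \<open>B\<close> gains the single element \<open>g\<close>.\<close>

lemma nut_graph_order_8g_degree_8s_plus_4:
  assumes s: "s \<ge> 1" "s < g"
  shows "\<exists>G :: nat pair_pre_digraph. regular_graph (nat (8 * s + 4)) G \<and> vertex_transitive G \<and>
    nut_graph G \<and> card (pverts G) = nat (8 * g)"
proof -
  let ?P = "insert g (insert (-g) (core s (2 * g)))" and ?B = "insert g (annulus s)"
  have g: "g \<notin> core s (2 * g)" "- g \<notin> core s (2 * g)" "g \<notin> annulus s"
    using s by (auto simp: mem_core mem_annulus)
  have "\<exists>G :: nat pair_pre_digraph. regular_graph (2 * nat (4 * s + 2)) G \<and> vertex_transitive G \<and>
    nut_graph G \<and> card (pverts G) = nat (4 * (2 * g))"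
  proof (rule swap_nut_graph[where P = ?P and B = ?B])
    show "?P \<subseteq> window (2 * (2 * g))"
      using s core_subset_window[of s "2 * g"] by (auto simp: window_def)
    show "card ?P = nat (4 * s + 2)"
      using s g card_core[of s "2 * g"] by (simp add: nat_add_distrib)
    show "- k \<in> ?P" if "k \<in> ?P" for k using that core_uminus by auto
    fix f :: "int \<Rightarrow> int" and i assume f: "periodic (2 * (2 * g)) f"
    have "f (i - g) = f (i + 2 * g + g)"
      using periodic_mult[OF f, of "i - g" 1] by (simp add: algebra_simps)
    then show "(\<Sum>k\<in>?P. f (i + k)) = (\<Sum>k\<in>?B. f (i + k)) + (\<Sum>k\<in>?B. f (i + 2 * g + k))"
      using s g sum_core_periodic[OF _ _ f, of s i] by simp
  qed (use s zero_not_in_core[of s "2 * g"] in \<open>auto simp: mem_core mem_annulus\<close>)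
  moreover have "2 * nat (4 * s + 2) = nat (8 * s + 4)" using s by simp
  ultimately show ?thesis by simp
qed

text \<open>Eliminating \<open>w\<close> gives \<open>(S\<^sup>k - 1)\<^sup>2 u = 0\<close> for \<open>k = 2 g + 1\<close>, which is prime to \<open>4 g\<close>.\<close>

lemma nut_graph_order_8g_degree_4:
  assumes g: "g \<ge> 1"
  shows "\<exists>G :: nat pair_pre_digraph. regular_graph 4 G \<and> vertex_transitive G \<and>
    nut_graph G \<and> card (pverts G) = nat (8 * g)"
proof -
  have "\<exists>G :: nat pair_pre_digraph. regular_graph (2 * 2) G \<and> vertex_transitive G \<and>
    nut_graph G \<and> card (pverts G) = nat (2 * (4 * g))"
  proof (rule bicirculant_nut_graph[where P = "{g, -g}" and Q = "{0, 1}"])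
    show "{g, -g} \<subseteq> window (4 * g)" "{0, 1} \<subseteq> window (4 * g)"
      using g by (auto simp: window_def)
    fix u w :: "int \<Rightarrow> real"
    assume per: "periodic (4 * g) u" "periodic (4 * g) w"
      and e1: "\<And>i. (\<Sum>k\<in>{g, -g}. u (i + k)) + (\<Sum>k\<in>{0, 1}. w (i + k)) = 0"
      and e2: "\<And>i. (\<Sum>k\<in>{g, -g}. w (i + k)) + (\<Sum>k\<in>{0, 1}. u (i - k)) = 0"
    have f1: "u (i + g) + u (i - g) + w i + w (i + 1) = 0" for i
      using e1[of i] g by simp
    have f2: "w (i + g) + w (i - g) + u i + u (i - 1) = 0" for i
      using e2[of i] g by simp
    have half: "u (i - 2 * g) = u (i + 2 * g)" for i
      using periodic_mult[OF per(1), of "i - 2 * g" 1] by (simp add: algebra_simps)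
    \<comment> \<open>Adding \<open>f1\<close> at \<open>i + g\<close> and \<open>i - g\<close>, the
      \<open>w\<close>-terms group into the left-hand sides of \<open>f2\<close> at \<open>i\<close>
      and \<open>i + 1\<close>.\<close>
    have two: "2 * u (i + 2 * g) = u (i - 1) + u (i + 1)" for i
    proof -
      have a: "i + g + g = i + 2 * g" "i + g - g = i" "i - g + g = i" "i - g - g = i - 2 * g"
        by auto
      show ?thesis
        using f1[of "i + g"] f1[of "i - g"] f2[of i] f2[of "i + 1"] half[of i]
        unfolding a by (simp add: algebra_simps)
    qed
    have "u (i + 2 * (2 * g + 1)) + u i = 2 * u (i + (2 * g + 1))" for i
      using periodic_mult[OF per(1), of "i + 2" 1] two[of "i + 1"]
      by (simp add: algebra_simps)
    moreover have "coprime (2 * g + 1) (4 * g)"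
    proof (rule coprimeI)
      fix x assume x: "x dvd 2 * g + 1" "x dvd 4 * g"
      have "x dvd 2 * (2 * g + 1) - 4 * g" by (rule dvd_diff[OF dvd_mult[OF x(1)] x(2)])
      then have "x dvd 2" by simp
      have "odd x" using x(1) by (metis dvd_trans even_add even_mult_iff even_numeral odd_one)
      then have "coprime x 2" by simp
      with \<open>x dvd 2\<close> show "is_unit x" by (metis coprime_absorb_left)
    qed
    ultimately have u: "u i = u 0" for i
      using periodic_second_difference_const[OF per(1)] g by simp
    have w1: "w i + w (i + 1) = - 2 * u 0" for i
      using f1[of i] u[of "i + g"] u[of "i - g"] by simp
    \<comment> \<open>Period 2 suffices to compare \<open>w (i + g)\<close> with
      \<open>w (i - g)\<close>, whose arguments differ by \<open>2 * g\<close>.\<close>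
    have "w (i + 2) = w i" for i
      using w1[of i] w1[of "i + 1"] by (simp add: algebra_simps)
    then have "periodic 2 w" by (simp add: periodic_def)
    then have "w (i + g) = w (i - g)" for i
      using periodic_mult[of 2 w "i - g" g] by (simp add: algebra_simps)
    then have "w (i + g) = - u 0" for i
      using f2[of i] u[of i] u[of "i - 1"] by simp
    then have "w i = - u 0" for i by (metis diff_add_cancel)
    with u show "\<exists>c. \<forall>i. u i = c \<and> w i = - c" by blast
  qed (use g in auto)
  then show ?thesis by simp
qed

section \<open>Families handled through the sum and the difference of the two sides\<close>

lemma sum_of_int_weighted:
  fixes g :: "int \<Rightarrow> 'a::comm_ring_1"
  assumes "finite A" "finite B" "A \<inter> B = {}"
  shows "(\<Sum>k\<in>A \<union> B. of_int (if k \<in> A then a else b k) * g k)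
    = of_int a * (\<Sum>k\<in>A. g k) + (\<Sum>k\<in>B. of_int (b k) * g k)"
proof -
  have "(\<Sum>k\<in>B. of_int (if k \<in> A then a else b k) * g k) = (\<Sum>k\<in>B. of_int (b k) * g k)"
    using assms(3) by (intro sum.cong) auto
  then show ?thesis
    using assms by (simp add: sum.union_disjoint sum_distrib_left)
qed

text \<open>The \<open>h\<close>-antiperiodic part of a kernel vector vanishes at once. On \<open>h\<close>-periodic functions
  \<open>(S\<^sup>c - 1)\<^sup>2 (u - w) = 0\<close>, and \<open>u + w\<close> is killed by a circulant congruent to \<open>S\<^sup>c + S\<^sup>-\<^sup>c\<close>
  modulo 2, where \<open>2 c = h + 1\<close>.\<close>

lemma nut_graph_order_4h_degree_8s_plus_4:
  assumes s: "s \<ge> 0" "2 * s + 1 < h" and odd: "odd h"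
  shows "\<exists>G :: nat pair_pre_digraph. regular_graph (nat (8 * s + 4)) G \<and> vertex_transitive G \<and>
    nut_graph G \<and> card (pverts G) = nat (4 * h)"
proof -
  \<comment> \<open>Since \<open>2 * c = h + 1\<close>, two shifts by \<open>c\<close> act on
    \<open>h\<close>-periodic functions as one shift by 1. The bounds \<open>s < c < h - s\<close>
    keep \<open>c\<close> and \<open>- c\<close> outside the core.\<close>
  define c where "c = (h + 1) div 2"
  then have h: "h = 2 * c - 1" using odd by (auto elim!: oddE)
  have c: "c > s" "c < h - s" "c > 0" using s h by auto
  let ?P = "insert c (insert (-c) (core s h))" and ?Q = "insert 0 (insert h (core s h))"
  have nin: "c \<notin> core s h" "- c \<notin> core s h" "0 \<notin> core s h" "h \<notin> core s h"
    "c \<notin> annulus s" "- c \<notin> annulus s" "0 \<notin> annulus s"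
    using s c by (auto simp: mem_core mem_annulus)
  have h0: "h > 0" and hc: "c \<noteq> - c" "h \<noteq> 0" using s c by auto
  have "\<exists>G :: nat pair_pre_digraph. regular_graph (2 * nat (4 * s + 2)) G \<and> vertex_transitive G \<and>
    nut_graph G \<and> card (pverts G) = nat (2 * (2 * h))"
  proof (rule bicirculant_nut_graph[where P = ?P and Q = ?Q])
    show "?P \<subseteq> window (2 * h)" "?Q \<subseteq> window (2 * h)"
      using s c h core_subset_window[of s h] by (auto simp: window_def)
    show "card ?P = nat (4 * s + 2)" "card ?Q = nat (4 * s + 2)"
      using s nin hc card_core[of s h] by (simp_all add: nat_add_distrib)
    show "- k \<in> ?P" if "k \<in> ?P" for k using that core_uminus by auto
    fix u w :: "int \<Rightarrow> real"
    assume per: "periodic (2 * h) u" "periodic (2 * h) w"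
      and e1: "\<And>i. (\<Sum>k\<in>?P. u (i + k)) + (\<Sum>k\<in>?Q. w (i + k)) = 0"
      and e2: "\<And>i. (\<Sum>k\<in>?P. w (i + k)) + (\<Sum>k\<in>?Q. u (i - k)) = 0"
    define Y where "Y f i = (\<Sum>k\<in>annulus s. f (i + k))" for f :: "int \<Rightarrow> real" and i
    have core: "(\<Sum>k\<in>core s h. f (i + k)) = Y f i + Y f (i + h)" if "periodic (2 * h) f" for f i
      unfolding Y_def using s that by (intro sum_core_periodic) auto
    have Yh: "Y f (i + h + h) = Y f i" if "periodic (2 * h) f" for f i
    proof -
      have "f (i + h + h + k) = f (i + k)" for k
        using periodic_mult[OF that, of "i + k" 1] by (simp add: algebra_simps)
      then show ?thesis by (simp add: Y_def)
    qed
    have f1: "u (i + c) + u (i - c) + (Y u i + Y u (i + h)) + (w i + w (i + h))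
        + (Y w i + Y w (i + h)) = 0" for i
      using e1[of i] nin hc by (simp add: core per)
    have f2: "w (i + c) + w (i - c) + (Y w i + Y w (i + h)) + (u i + u (i - h))
        + (Y u i + Y u (i + h)) = 0" for i
      using e2[of i] nin hc sum_uminus_symmetric[of "core s h" "\<lambda>k. u (i + k)"] core_uminus
      by (simp add: core per)
    have "u (i - h) = u (i + h)" for i
      using periodic_mult[OF per(1), of "i - h" 1] by (simp add: algebra_simps)
    note f2 = f2[unfolded this]
    \<comment> \<open>The antiperiodic difference \<open>a\<close> satisfies
      \<open>a (i + 2 * c) = - a i\<close>. As \<open>2 * c = h + 1\<close>, this says
      \<open>a (i + 1) = a i\<close>, and a constant antiperiodic function is zero.\<close>
    have half: "f (i + h) = f i"
      if f: "periodic (2 * h) f" "\<And>i. f (i + h + c) + f (i + h - c) = f (i + c) + f (i - c)"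
      for f :: "int \<Rightarrow> real" and i
    proof -
      define a where "a i = f (i + h) - f i" for i
      have anti: "a (i + h) = - a i" for i
        using periodic_mult[OF f(1), of i 1] by (simp add: a_def algebra_simps)
      have "a (i + 1) = a i + 0" for i
      proof -
        have "i + c + c = i + 1 + h" using h by simp
        then have "a (i + 1 + h) = - a i"
          using f(2)[of "i + c"] by (simp add: a_def algebra_simps)
        then show ?thesis using anti[of "i + 1"] by simp
      qed
      from iterate_shift[of a 1 0 i h, OF this] anti[of i] have "a i = 0" by simp
      then show ?thesis by (simp add: a_def)
    qed
    have swap: "x + h + h = x + 2 * h" for x by simp
    \<comment> \<open>In \<open>f1\<close> every term apart from \<open>u (i + c)\<close> and
      \<open>u (i - c)\<close> belongs to a group invariant under the shift by \<open>h\<close>;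
      likewise for \<open>w\<close> in \<open>f2\<close>.\<close>
    have per_h: "u (i + h) = u i" "w (i + h) = w i" for i
    proof -
      have u2: "u (j + h + h) = u j" and w2: "w (j + h + h) = w j" for j
        using per unfolding swap by (simp_all add: periodic_def)
      show "u (i + h) = u i"
        by (rule half[OF per(1)]) (use f1 in \<open>smt (verit) Yh per u2 w2\<close>)
      show "w (i + h) = w i"
        by (rule half[OF per(2)]) (use f2 in \<open>smt (verit) Yh per u2 w2\<close>)
    qed
    have Y2: "Y u (i + h) = Y u i" "Y w (i + h) = Y w i" for i
    proof -
      have "i + h + k = i + k + h" for k by simp
      then show "Y u (i + h) = Y u i" "Y w (i + h) = Y w i"
        unfolding Y_def by (simp_all only: per_h)
    qed
    have g1: "u (i + c) + u (i - c) + 2 * Y u i + 2 * w i + 2 * Y w i = 0" for i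
      using f1[of i] by (simp add: per_h Y2)
    have g2: "w (i + c) + w (i - c) + 2 * Y w i + 2 * u i + 2 * Y u i = 0" for i
      using f2[of i] by (simp add: per_h Y2)
    have d: "u i - w i = u 0 - w 0" for i
    proof (rule periodic_second_difference_const[where m = h and k = c])
      show "periodic h (\<lambda>i. u i - w i)" by (simp add: periodic_def per_h)
      show "coprime c h"
      proof (rule coprimeI)
        fix x assume "x dvd c" "x dvd h"
        then have "x dvd 2 * c - h" by (intro dvd_diff dvd_mult)
        then show "is_unit x" by (simp add: h)
      qed
      show "u (i + 2 * c) - w (i + 2 * c) + (u i - w i) = 2 * (u (i + c) - w (i + c))" for i
        using g1[of "i + c"] g2[of "i + c"] by (simp add: algebra_simps)
    qed (rule h0)
    \<comment> \<open>Adding \<open>g1\<close> and \<open>g2\<close> gives weight 4 on the annulus,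
      2 at 0, and 1 at \<open>c\<close> and \<open>- c\<close>. The total weight
      \<open>8 * s + 4\<close> is nonzero, so integer kernel vectors sum to zero over a
      period.\<close>
    have p: "u i + w i = 0" for i
    proof (rule circulant_kernel_trivial[where m = h and v = "\<lambda>i. u i + w i" and
          K = "annulus s \<union> {0, c, -c}" and
          a = "\<lambda>k. if k \<in> annulus s then 4 else if k = 0 then 2 else 1"])
      have disj: "annulus s \<inter> {0, c, -c} = {}" using nin by auto
      note weighted = sum_of_int_weighted[OF finite_annulus _ disj, of 4 "\<lambda>k. if k = 0 then 2 else 1"]
      show "periodic h (\<lambda>i. u i + w i)" by (simp add: periodic_def per_h)
      show "(\<Sum>k\<in>annulus s \<union> {0, c, -c}. of_int (if k \<in> annulus s then 4 else if k = 0 then 2 else 1)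
          * (u (i + k) + w (i + k))) = 0" for i
        using g1[of i] g2[of i] c by (subst weighted) (simp_all add: Y_def sum.distrib algebra_simps)
      fix z :: "int \<Rightarrow> int" and i
      let ?a = "\<lambda>k. if k \<in> annulus s then 4 else if k = 0 then 2 else 1 :: int"
      assume z: "periodic h z" "\<And>i. (\<Sum>k\<in>annulus s \<union> {0, c, -c}. ?a k * z (i + k)) = 0"
      have eq: "4 * (\<Sum>k\<in>annulus s. z (i + k)) + (2 * z i + (z (i + c) + z (i - c))) = 0" for i
        using z(2)[of i] weighted[of "\<lambda>k. z (i + k)"] c by simp
      show "even (z i)"
      proof (rule even_of_consecutive_parity[OF odd h0, where z = z])
        show "even (z i + z (i + 1))" for i
        proof -
          have "z (i + c + c) = z (i + 1)"
            using periodic_mult[OF z(1), of "i + 1" 1] h by (simp add: algebra_simps)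
          then have "z i + z (i + 1)
              = 2 * (- 2 * (\<Sum>k\<in>annulus s. z (i + c + k)) - z (i + c))"
            using eq[of "i + c"] by (simp add: algebra_simps)
          then show ?thesis by simp
        qed
        have "(\<Sum>k\<in>annulus s \<union> {0, c, -c}. ?a k) = 8 * s + 4"
          using weighted[of "\<lambda>_. 1 :: int"] c s card_annulus[of s] by simp
        then have "(\<Sum>i\<in>{0..<h}. z i) = 0"
          using circulant_sum_zero[OF z(1) h0 z(2)] s by simp
        then show "even (\<Sum>i\<in>{0..<h}. z i)" by simp
      qed
    qed (rule h0)
    have "u i = u 0 \<and> w i = - u 0" for i
      using d[of i] p[of i] p[of 0] by linarith
    then show "\<exists>c. \<forall>i. u i = c \<and> w i = - c" by blast
  qed (use h0 nin c in auto)
  moreover have "2 * nat (4 * s + 2) = nat (8 * s + 4)" using s by simp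
  ultimately show ?thesis by simp
qed

text \<open>Here \<open>(S\<^sup>2 - 1) (S - 1) (u - w) = 0\<close>, and \<open>u + w\<close> is killed by a circulant congruent to
  \<open>(S\<^sup>2 + 1) (S + 1)\<close> modulo 2, up to a power of \<open>S\<close>.\<close>

lemma nut_graph_order_4h_plus_2_degree_4t:
  assumes t: "t \<ge> 1" "t < h"
  shows "\<exists>G :: nat pair_pre_digraph. regular_graph (nat (4 * t)) G \<and> vertex_transitive G \<and>
    nut_graph G \<and> card (pverts G) = nat (4 * h + 2)"
proof -
  define m where "m = 2 * h + 1"
  define N where "N = annulus (t - 1)"
  \<comment> \<open>Modulo \<open>2 * h + 1\<close> the residues of \<open>h - 1\<close>,
    \<open>h\<close>, \<open>- h\<close>, \<open>1 - h\<close> are the four consecutive numbers from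
    \<open>h - 1\<close> to \<open>h + 2\<close>: the outer two go to \<open>P\<close>, the inner
    two to \<open>Q\<close>.\<close>
  let ?P = "insert (h - 1) (insert (1 - h) N)" and ?Q = "insert h (insert (-h) N)"
  have m: "m > 0" "odd m" using t by (auto simp: m_def)
  have nin: "h - 1 \<notin> N" "1 - h \<notin> N" "h \<notin> N" "- h \<notin> N"
    using t by (auto simp: N_def mem_annulus)
  have fin: "finite N" by (simp add: N_def)
  have cardN: "card N = nat (2 * t - 2)" using t card_annulus[of "t - 1"] by (simp add: N_def)
  have symP: "- k \<in> ?P" if "k \<in> ?P" for k
    using that annulus_uminus[of k "t - 1"] by (auto simp: N_def)
  have symQ: "- k \<in> ?Q" if "k \<in> ?Q" for k
    using that annulus_uminus[of k "t - 1"] by (auto simp: N_def)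
  have "\<exists>G :: nat pair_pre_digraph. regular_graph (2 * nat (2 * t)) G \<and> vertex_transitive G \<and>
    nut_graph G \<and> card (pverts G) = nat (2 * m)"
  proof (rule bicirculant_nut_graph[where P = ?P and Q = ?Q])
    show "?P \<subseteq> window m" "?Q \<subseteq> window m"
      using t by (auto simp: window_def m_def N_def mem_annulus)
    show "card ?P = nat (2 * t)" "card ?Q = nat (2 * t)"
      using t nin fin cardN by simp_all
    show "0 \<notin> ?P" using t by (auto simp: N_def mem_annulus)
    show "- k \<in> ?P" if "k \<in> ?P" for k using symP[OF that] .
    fix u w :: "int \<Rightarrow> real"
    assume per: "periodic m u" "periodic m w"
      and e1: "\<And>i. (\<Sum>k\<in>?P. u (i + k)) + (\<Sum>k\<in>?Q. w (i + k)) = 0"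
      and e2: "\<And>i. (\<Sum>k\<in>?P. w (i + k)) + (\<Sum>k\<in>?Q. u (i - k)) = 0"
    define Y where "Y f i = (\<Sum>k\<in>N. f (i + k))" for f :: "int \<Rightarrow> real" and i
    have f1: "u (i + (h - 1)) + u (i + (1 - h)) + Y u i + w (i + h) + w (i - h) + Y w i = 0" for i
      using e1[of i] nin fin t by (simp add: Y_def)
    have f2: "w (i + (h - 1)) + w (i + (1 - h)) + Y w i + u (i + h) + u (i - h) + Y u i = 0" for i
      using e2[of i] nin fin t sum_uminus_symmetric[of ?Q "\<lambda>k. u (i + k)", OF symQ]
      by (simp add: Y_def)
    define d where "d i = u i - w i" for i
    have perd: "periodic m d" using per by (simp add: periodic_def d_def)
    have d1: "d (i + 3) - d (i + 1) = d (i + 2) - d i" for i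
    proof -
      \<comment> \<open>This base point moves the four consecutive residues to \<open>i\<close>,
        \<open>i + 1\<close>, \<open>i + 2\<close>, \<open>i + 3\<close>.\<close>
      let ?j = "i + 1 - h"
      have "d (?j + (h - 1)) + d (?j + (1 - h)) = d (?j + h) + d (?j - h)"
        using f1[of ?j] f2[of ?j] by (simp add: d_def)
      moreover have "d (?j + (1 - h)) = d (i + 3)" "d (?j - h) = d (i + 2)"
        using periodic_mult[OF perd, of "?j + (1 - h)" 1] periodic_mult[OF perd, of "?j - h" 1]
        by (simp_all add: m_def algebra_simps)
      ultimately show ?thesis by simp
    qed
    define e where "e i = d (i + 2) - d i" for i
    have "e (i + 1) = e i + 0" for i using d1[of i] by (simp add: e_def add.commute)
    from iterate_shift[of e 1 0 0, OF this] have "d (i + 2) = d i + e 0" for i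
      by (simp add: e_def algebra_simps)
    then have d: "d i = d 0" for i
      using periodic_shift_const(2)[OF perd m(1), of 2] m(2) by simp
    have p: "u i + w i = 0" for i
    proof (rule circulant_kernel_trivial[where m = m and v = "\<lambda>i. u i + w i" and
          K = "N \<union> {h - 1, 1 - h, h, -h}" and a = "\<lambda>k. if k \<in> N then 2 else 1"])
      have disj: "N \<inter> {h - 1, 1 - h, h, -h} = {}" using nin by auto
      note weighted = sum_of_int_weighted[OF fin _ disj, of 2 "\<lambda>_. 1"]
      show "periodic m (\<lambda>i. u i + w i)" using per by (simp add: periodic_def)
      show "(\<Sum>k\<in>N \<union> {h - 1, 1 - h, h, -h}. of_int (if k \<in> N then 2 else 1)
          * (u (i + k) + w (i + k))) = 0" for i
        using f1[of i] f2[of i] t by (subst weighted) (simp_all add: Y_def sum.distrib algebra_simps)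
      fix z :: "int \<Rightarrow> int" and i
      let ?a = "\<lambda>k. if k \<in> N then 2 else 1 :: int"
      assume z: "periodic m z" "\<And>i. (\<Sum>k\<in>N \<union> {h - 1, 1 - h, h, -h}. ?a k * z (i + k)) = 0"
      have eq: "2 * (\<Sum>k\<in>N. z (i + k)) + (z (i + (h - 1)) + z (i + (1 - h)) + z (i + h) + z (i - h)) = 0"
        for i
        using z(2)[of i] weighted[of "\<lambda>k. z (i + k)"] t by simp
      have four: "even (z i + z (i + 1) + z (i + 2) + z (i + 3))" for i
      proof -
        let ?j = "i + 1 - h"
        have "z (?j + (1 - h)) = z (i + 3)" "z (?j - h) = z (i + 2)"
          using periodic_mult[OF z(1), of "?j + (1 - h)" 1] periodic_mult[OF z(1), of "?j - h" 1]
          by (simp_all add: m_def algebra_simps)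
        then have "z i + z (i + 1) + z (i + 2) + z (i + 3) = 2 * - (\<Sum>k\<in>N. z (?j + k))"
          using eq[of ?j] by simp
        then show ?thesis by simp
      qed
      have "(\<Sum>k\<in>N \<union> {h - 1, 1 - h, h, -h}. ?a k) = 4 * t"
        using weighted[of "\<lambda>_. 1 :: int"] t cardN by simp
      then have sum: "(\<Sum>i\<in>{0..<m}. z i) = 0"
        using circulant_sum_zero[OF z(1) m(1) z(2)] t by simp
      \<comment> \<open>Modulo 2 the factor \<open>S + 1\<close> is removed first, acting on
        \<open>z i + z (i + 2)\<close>; what remains says that the parity of \<open>z\<close> has
        period 2.\<close>
      have "even (z i + z (i + 2))" for i
      proof (rule even_of_consecutive_parity[OF m(2,1), where z = "\<lambda>i. z i + z (i + 2)"])
        show "even (z i + z (i + 2) + (z (i + 1) + z (i + 1 + 2)))" for i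
          using four[of i] by (simp add: algebra_simps)
        show "even (\<Sum>i\<in>{0..<m}. z i + z (i + 2))"
          using sum sum_shift_period[OF z(1) m(1), of 2] by (simp add: sum.distrib)
      qed
      then have "periodic 2 (\<lambda>i. even (z i))" by (auto simp: periodic_def)
      then have par: "even (z (i + n * 2)) \<longleftrightarrow> even (z i)" for i n by (rule periodic_mult)
      show "even (z i)"
      proof (rule even_of_consecutive_parity[OF m(2,1), where z = z])
        show "even (z i + z (i + 1))" for i
        proof -
          \<comment> \<open>As \<open>2 * (h + 1) = m + 1\<close>, period 2 of the parity yields
            period 1.\<close>
          have "z (i + (h + 1) * 2) = z (i + 1)"
            using periodic_mult[OF z(1), of "i + 1" 1] by (simp add: m_def algebra_simps)
          with par[of i "h + 1"] show ?thesis by simp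
        qed
        show "even (\<Sum>i\<in>{0..<m}. z i)" using sum by simp
      qed
    qed (rule m(1))
    have "u i = u 0 \<and> w i = - u 0" for i
      using d[of i] p[of i] p[of 0] by (simp add: d_def)
    then show "\<exists>c. \<forall>i. u i = c \<and> w i = - c" by blast
  qed (rule m(1))
  moreover have "2 * nat (2 * t) = nat (4 * t)" "2 * m = 4 * h + 2" using t by (auto simp: m_def)
  ultimately show ?thesis by simp
qed

text \<open>With \<open>n = 2 * m\<close> and \<open>d = 4 * t\<close>, the cases are
  \<open>m\<close> odd; \<open>m\<close> even with \<open>t\<close> even; and \<open>m\<close> even
  with \<open>t\<close> odd, divided by the parity of \<open>h = m / 2\<close>, with
  \<open>d = 4\<close> separate when \<open>h\<close> is even. The bound
  \<open>m \<ge> 2 * t + 2\<close> supplies the inequality that each family requires.\<close>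

lemma nut_graph_exists:
  fixes d n :: nat
  assumes "d > 0" "4 dvd d" "even n" "n \<ge> d + 4"
  shows "\<exists>G :: nat pair_pre_digraph.
    regular_graph d G \<and> vertex_transitive G \<and> nut_graph G \<and> card (pverts G) = n"
proof -
  obtain t where t: "d = 4 * t" using assms(2) by blast
  obtain m where m: "n = 2 * m" using assms(3) by blast
  have mt: "t \<ge> 1" "m \<ge> 2 * t + 2" using assms t m by auto
  show ?thesis
  proof (cases "even m")
    case False
    then obtain h where h: "m = 2 * h + 1" by (elim oddE)
    then have "n = nat (4 * int h + 2)" "d = nat (4 * int t)" using t m by auto
    then show ?thesis
      using nut_graph_order_4h_plus_2_degree_4t[of "int t" "int h"] mt h by simp
  next
    case True
    then obtain h where h: "m = 2 * h" by blast
    then have n: "n = nat (4 * int h)" using m by simp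
    show ?thesis
    proof (cases "even t")
      case True
      then obtain s where s: "t = 2 * s" by blast
      then have "d = nat (8 * int s)" using t by simp
      then show ?thesis
        using nut_graph_order_4h_degree_8s[of "int s" "int h"] n mt h s by simp
    next
      case False
      then obtain s where s: "t = 2 * s + 1" by (elim oddE)
      then have d: "d = nat (8 * int s + 4)" using t by simp
      show ?thesis
      proof (cases "even h")
        case False
        then show ?thesis
          using nut_graph_order_4h_degree_8s_plus_4[of "int s" "int h"] n d mt h s by simp
      next
        case True
        then obtain g where g: "h = 2 * g" by blast
        then have n: "n = nat (8 * int g)" using n by simp
        show ?thesis
        proof (cases "s = 0")
          case True
          then show ?thesis
            using nut_graph_order_8g_degree_4[of "int g"] n d mt h g by simp
        next
          case False
          then show ?thesis
            using nut_graph_order_8g_degree_8s_plus_4[of "int s" "int g"] n d mt h g s by simp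
        qed
      qed
    qed
  qed
qed

theorem corollary9:
  fixes d n :: nat
  assumes "d > 0" and "4 dvd d" and "n > 0"
  shows "(\<exists>G :: nat pair_pre_digraph.
            regular_graph d G \<and> vertex_transitive G \<and> nut_graph G \<and> card (pverts G) = n)
         \<longleftrightarrow> 2 dvd n \<and> n \<ge> d + 4"
proof -
  have "even d" using assms(2) by (rule dvd_trans[rotated]) simp
  then show ?thesis
    using nut_graph_order_necessary[OF assms(1)] nut_graph_exists[OF assms(1,2)] by blast
qed

end
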